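(* Let $\rho_1,\rho_2$ be convex expectations on $L^\infty(\mu)$ that are continuous from below, and suppose that there exist two constants $u>\max\{0,M-\rho_1(0)+1\}$ and $v>\max\{0,M-\rho_2(0)+1\}$ such that $\mathcal{G}_u$ and $\mathcal{H}_v$ are both closed under $\mu$-a.e. convergence. Let $Q^*\in\mathcal{Q}$ be a probability measure such that $E_{Q^*}[K_2-X^*]=\inf_{X\in\mathcal{X}_\alpha}E_{Q^*}[K_2-X]$ for every optimal test $X^*$ of the problem of minimizing $\rho_2(K_2-X)$ over $X\in\mathcal{X}_\alpha$. Set $\gamma_\alpha=\inf_{X\in\mathcal{X}_\alpha}E_{Q^*}[K_2-X]$ and suppose $\gamma_\alpha>0$. Let $$\mathcal{X}^{\gamma_\alpha}=\{X\in L^\infty(\mu):E_{Q^*}[K_2-X]\le\gamma_\alpha,\ K_1\le X\le K_2\}.$$ Then there exists $P^*\in\mathcal{P}$ such that for any optimal test $X^*$ of the problem of minimizing $\rho_2(K_2-X)$ over $X\in\mathcal{X}_\alpha$, $$E_{P^*}[X^*]=\inf_{X\in\mathcal{X}^{\gamma_\alpha}}E_{P^*}[X].$$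
   Context: $(\Omega,\mathcal{F},\mu)$ is a probability space and $\mathcal{M}$ is the set of probability measures on $(\Omega,\mathcal{F})$ absolutely continuous with respect to $\mu$. For $P,Q\in\mathcal{M}$ write $G_P=\frac{dP}{d\mu}$ and $H_Q=\frac{dQ}{d\mu}$. A convex expectation on $L^\infty(\mu)$ is a map $\rho:L^\infty(\mu)\to\mathbb{R}$ such that for all $X,Y\in L^\infty(\mu)$: (i) $X\ge Y$ implies $\rho(X)\ge\rho(Y)$; (ii) $\rho(X+c)=\rho(X)+c$ for every constant $c$; (iii) $\rho(\lambda X+(1-\lambda)Y)\le\lambda\rho(X)+(1-\lambda)\rho(Y)$ for $\lambda\in[0,1]$. It is continuous from below if $\rho(X_n)\to\rho(X)$ whenever $(X_n)\subset L^\infty(\mu)$ increases to $X\in L^\infty(\mu)$. The penalty function is $\rho^*(P)=\sup_{X\in L^\infty(\mu)}(E_P[X]-\rho(X))$ for $P\in\mathcal{M}$. $\mathcal{P}=\{P\in\mathcal{M}:\rho_1^*(P)<\infty\}$, $\mathcal{Q}=\{Q\in\mathcal{M}:\rho_2^*(Q)<\infty\}$, and for a constant $c$, $\mathcal{G}_c=\{G_P:P\in\mathcal{P},\ \rho_1^*(P)\le c\}$, $\mathcal{H}_c=\{H_Q:Q\in\mathcal{Q},\ \rho_2^*(Q)\le c\}$. A set of random variables is closed under $\mu$-a.e. convergence if the $\mu$-a.e. limit of any $\mu$-a.e. convergent sequence in it belongs to it. $K_1,K_2\in L^\infty(\mu)$ are fixed with $0\le K_1<K_2$ ($\mu$-a.e.),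 $M$ is the least (essential) upper bound of $K_1$ and $K_2$, and $\alpha$ is a fixed real number (significance level) with $\rho_1(K_1)\le\alpha\le\rho_1(K_2)$. $\mathcal{X}_\alpha=\{X\in L^\infty(\mu):K_1\le X\le K_2,\ \rho_1(X)\le\alpha\}$. An optimal test is an $X^*\in\mathcal{X}_\alpha$ with $\rho_2(K_2-X^* )=\inf_{X\in\mathcal{X}_\alpha}\rho_2(K_2-X)$. *)

theory Defs
  imports "HOL-Probability.Probability"
begin

text \<open>
  Elements of \<open>L\<^sup>\<infinity>\<close> and densities are represented by functions rather than by classes modulo
  null sets, so every order relation, equality or limit between them is taken almost everywhere.
\<close>

definition Linf :: "'a measure \<Rightarrow> ('a \<Rightarrow> real) set" where
  "Linf \<mu> = {X \<in> borel_measurable \<mu>. \<exists>C. AE x in \<mu>. \<bar>X x\<bar> \<le> C}"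

definition ac_prob_measures :: "'a measure \<Rightarrow> 'a measure set" where
  "ac_prob_measures \<mu> = {P. prob_space P \<and> sets P = sets \<mu> \<and> absolutely_continuous \<mu> P}"

definition density_of :: "'a measure \<Rightarrow> 'a measure \<Rightarrow> 'a \<Rightarrow> real" where
  "density_of \<mu> P = (\<lambda>x. enn2real (RN_deriv \<mu> P x))"

text \<open>
  Only the values of \<open>\<rho>\<close> on \<^const>\<open>Linf\<close> matter. Monotonicity with respect to the a.e. order
  forces \<open>\<rho>\<close> to agree on a.e. equal functions, hence to be well defined on classes.
\<close>

definition convex_expectation :: "'a measure \<Rightarrow> (('a \<Rightarrow> real) \<Rightarrow> real) \<Rightarrow> bool" where
  "convex_expectation \<mu> \<rho> \<longleftrightarrow>
     (\<forall>X\<in>Linf \<mu>. \<forall>Y\<in>Linf \<mu>. (AE x in \<mu>. X x \<ge> Y x) \<longrightarrow> \<rho> X \<ge> \<rho> Y) \<and>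
     (\<forall>X\<in>Linf \<mu>. \<forall>c. \<rho> (\<lambda>x. X x + c) = \<rho> X + c) \<and>
     (\<forall>X\<in>Linf \<mu>. \<forall>Y\<in>Linf \<mu>. \<forall>l\<in>{0..1}.
        \<rho> (\<lambda>x. l * X x + (1 - l) * Y x) \<le> l * \<rho> X + (1 - l) * \<rho> Y)"

definition continuous_from_below :: "'a measure \<Rightarrow> (('a \<Rightarrow> real) \<Rightarrow> real) \<Rightarrow> bool" where
  "continuous_from_below \<mu> \<rho> \<longleftrightarrow>
     (\<forall>Xs X. (\<forall>n. Xs n \<in> Linf \<mu>) \<and> X \<in> Linf \<mu> \<and>
        (AE x in \<mu>. incseq (\<lambda>n. Xs n x)) \<and> (AE x in \<mu>. (\<lambda>n. Xs n x) \<longlonglongrightarrow> X x)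
        \<longrightarrow> (\<lambda>n. \<rho> (Xs n)) \<longlonglongrightarrow> \<rho> X)"

definition penalty :: "'a measure \<Rightarrow> (('a \<Rightarrow> real) \<Rightarrow> real) \<Rightarrow> 'a measure \<Rightarrow> ereal" where
  "penalty \<mu> \<rho> P = (SUP X\<in>Linf \<mu>. ereal (integral\<^sup>L P X - \<rho> X))"

definition finite_penalty_measures ::
    "'a measure \<Rightarrow> (('a \<Rightarrow> real) \<Rightarrow> real) \<Rightarrow> 'a measure set" where
  "finite_penalty_measures \<mu> \<rho> = {P \<in> ac_prob_measures \<mu>. penalty \<mu> \<rho> P < \<infinity>}"

definition density_level_set ::
    "'a measure \<Rightarrow> (('a \<Rightarrow> real) \<Rightarrow> real) \<Rightarrow> real \<Rightarrow> ('a \<Rightarrow> real) set" where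
  "density_level_set \<mu> \<rho> c =
     {density_of \<mu> P | P. P \<in> finite_penalty_measures \<mu> \<rho> \<and> penalty \<mu> \<rho> P \<le> ereal c}"

text \<open>Membership of the limit is membership of its class, hence the a.e. equal \<open>h\<close>.\<close>

definition closed_under_AE_convergence :: "'a measure \<Rightarrow> ('a \<Rightarrow> real) set \<Rightarrow> bool" where
  "closed_under_AE_convergence \<mu> S \<longleftrightarrow>
     (\<forall>f g. (\<forall>n. f n \<in> S) \<and> g \<in> borel_measurable \<mu> \<and> (AE x in \<mu>. (\<lambda>n. f n x) \<longlonglongrightarrow> g x)
        \<longrightarrow> (\<exists>h\<in>S. AE x in \<mu>. h x = g x))"

definition ess_upper_bound :: "'a measure \<Rightarrow> ('a \<Rightarrow> real) \<Rightarrow> ('a \<Rightarrow> real) \<Rightarrow> real" where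
  "ess_upper_bound \<mu> K1 K2 = real_of_ereal (esssup \<mu> (\<lambda>x. ereal (max (K1 x) (K2 x))))"

definition tests_between :: "'a measure \<Rightarrow> ('a \<Rightarrow> real) \<Rightarrow> ('a \<Rightarrow> real) \<Rightarrow> ('a \<Rightarrow> real) set" where
  "tests_between \<mu> K1 K2 = {X \<in> Linf \<mu>. AE x in \<mu>. K1 x \<le> X x \<and> X x \<le> K2 x}"

definition level_tests ::
    "'a measure \<Rightarrow> (('a \<Rightarrow> real) \<Rightarrow> real) \<Rightarrow> ('a \<Rightarrow> real) \<Rightarrow> ('a \<Rightarrow> real) \<Rightarrow> real
      \<Rightarrow> ('a \<Rightarrow> real) set" where
  "level_tests \<mu> \<rho>1 K1 K2 \<alpha> = {X \<in> tests_between \<mu> K1 K2. \<rho>1 X \<le> \<alpha>}"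

text \<open>
  The real-valued infimum is the genuine one when \<open>\<rho>1 K1 \<le> \<alpha>\<close> and \<open>\<rho>2\<close> is a convex expectation: the
  index set contains \<open>K1\<close> and the values are bounded below by \<open>\<rho>2 (\<lambda>_. 0)\<close>.
\<close>

definition optimal_test ::
    "'a measure \<Rightarrow> (('a \<Rightarrow> real) \<Rightarrow> real) \<Rightarrow> (('a \<Rightarrow> real) \<Rightarrow> real) \<Rightarrow> ('a \<Rightarrow> real) \<Rightarrow> ('a \<Rightarrow> real)
      \<Rightarrow> real \<Rightarrow> ('a \<Rightarrow> real) \<Rightarrow> bool" where
  "optimal_test \<mu> \<rho>1 \<rho>2 K1 K2 \<alpha> X' \<longleftrightarrow>
     X' \<in> level_tests \<mu> \<rho>1 K1 K2 \<alpha> \<and>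
     \<rho>2 (\<lambda>x. K2 x - X' x) = (INF X\<in>level_tests \<mu> \<rho>1 K1 K2 \<alpha>. \<rho>2 (\<lambda>x. K2 x - X x))"

definition dual_tests ::
    "'a measure \<Rightarrow> 'a measure \<Rightarrow> ('a \<Rightarrow> real) \<Rightarrow> ('a \<Rightarrow> real) \<Rightarrow> real \<Rightarrow> ('a \<Rightarrow> real) set" where
  "dual_tests \<mu> Q K1 K2 \<gamma> =
     {X \<in> tests_between \<mu> K1 K2. integral\<^sup>L Q (\<lambda>x. K2 x - X x) \<le> \<gamma>}"

end

theory Submission
  imports Defs
begin

text \<open>
  Let \<open>D\<close> be the set of tests \<open>X\<close> between \<open>K1\<close> and \<open>K2\<close> with \<open>E\<^sub>Q[K2 - X] \<le> \<gamma>\<close>. Every optimal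
  test lies in \<open>D\<close> and satisfies \<open>\<rho>1 X \<le> \<alpha>\<close>, whereas \<open>\<rho>1 \<ge> \<alpha>\<close> on all of \<open>D\<close>
  (\<open>convex_expectation_ge_on_dual_tests\<close>); so the optimal tests minimise \<open>\<rho>1\<close> over \<open>D\<close>. Suppose
  there is a measure \<open>P\<close> with
  \<open>E\<^sub>P[Y] - \<rho>1 Y \<le> E\<^sub>P[X] - \<alpha>\<close> for all \<open>X\<close> in \<open>D\<close> and all essentially bounded \<open>Y\<close>, that is, a maximiser of the dual side of the minimax identity
  \<open>\<alpha> = max\<^sub>P inf\<^sub>X (E\<^sub>P[X] - \<rho>1*(P))\<close>. Fixing \<open>X\<close> shows that its penalty is finite. Taking for \<open>Y\<close>
  an optimal test shows that \<open>Y\<close> minimises \<open>E\<^sub>P\<close> over \<open>D\<close>, and this for all optimal tests with the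
  same \<open>P\<close>.

  The work is to find \<open>P\<close> (\<open>saddle_measure_exists\<close>). The Hahn-Banach theorem separates \<open>\<rho>1\<close> from
  the constant \<open>\<alpha>\<close> on \<open>D\<close>, but it yields a finitely additive functional. To force countable
  additivity, \<open>D\<close> is first enlarged: continuity from below makes \<open>\<rho>1\<close> lower semicontinuous along
  bounded a.e. convergent sequences, and a compactness argument makes this uniform, so that
  perturbations of each size \<open>k\<close> with sufficiently small mean may be subtracted from \<open>D\<close> while
  \<open>\<rho>1\<close> stays above \<open>\<alpha> - \<delta>\<close> (\<open>convex_expectation_thickening\<close>). A functional separating on the
  enlarged set is uniformly small on events of small probability and thus an expectation
  (\<open>approximate_saddle_measure\<close>). This route contains both the dual representation of \<open>\<rho>1\<close> and the
  minimax theorem.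

  The measures so obtained for \<open>\<delta> \<rightarrow> 0\<close> have penalties at most \<open>u\<close>. Komlos' theorem
  (\<open>tail_averages_AE_convergent\<close>) gives convex combinations of their densities that converge a.e.,
  and the closedness of the level set keeps the limit a probability density of finite penalty.

  Compactness is used throughout in the form of forward convex combinations: bounded or nonnegative
  sequences have a.e. convergent ones, and convexity carries every inequality along.
\<close>

section \<open>Forward convex combinations\<close>

text \<open>
  A forward convex combination of a sequence is encoded as the functional that forms it, so that
  one choice of weights can be applied at once to several sequences of functions, to their
  integrals, or to numbers.
\<close>

inductive_set tail_averages :: "nat \<Rightarrow> ((nat \<Rightarrow> real) \<Rightarrow> real) set" for n where
  point: "n \<le> j \<Longrightarrow> (\<lambda>s. s j) \<in> tail_averages n"
| mix: "\<lbrakk>A \<in> tail_averages n; B \<in> tail_averages n; 0 \<le> t; t \<le> 1\<rbrakk>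
    \<Longrightarrow> (\<lambda>s. t * A s + (1 - t) * B s) \<in> tail_averages n"

definition function_convex :: "('a \<Rightarrow> real) set \<Rightarrow> bool" where
  "function_convex S \<longleftrightarrow>
     (\<forall>f\<in>S. \<forall>g\<in>S. \<forall>t\<in>{0..1}. (\<lambda>x. t * f x + (1 - t) * g x) \<in> S)"

lemma tail_averages_mono:
  assumes "A \<in> tail_averages m" "n \<le> m" shows "A \<in> tail_averages n"
  using assms by induction (auto intro: tail_averages.intros)

lemma tail_average_linear:
  assumes "A \<in> tail_averages n"
  shows "A (\<lambda>j. a * s j + b * r j) = a * A s + b * A r"
  using assms by induction (auto simp: algebra_simps)

lemma tail_average_diff:
  assumes "A \<in> tail_averages n" shows "A (\<lambda>j. s j - r j) = A s - A r"
  using tail_average_linear[OF assms, of 1 s "-1" r] by simp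

lemma tail_average_cmult:
  assumes "A \<in> tail_averages n" shows "A (\<lambda>j. s j * c) = A s * c"
  using assms by induction (auto simp: algebra_simps)

lemma tail_average_const:
  assumes "A \<in> tail_averages n" shows "A (\<lambda>_. c) = c"
  using assms by induction (auto simp: algebra_simps)

lemma tail_average_mono:
  assumes "A \<in> tail_averages n" and "\<And>j. n \<le> j \<Longrightarrow> s j \<le> r j" shows "A s \<le> A r"
  using assms by induction (auto intro!: add_mono mult_left_mono)

text \<open>
  Passing from a sequence in a convex set to averages of its tails therefore costs nothing: bounds,
  convex constraints and sublevel sets of convex functionals all survive.
\<close>

lemma tail_average_in_convex:
  assumes "A \<in> tail_averages n" and "function_convex S" and "\<And>j. n \<le> j \<Longrightarrow> X j \<in> S"
  shows "(\<lambda>x. A (\<lambda>j. X j x)) \<in> S"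
  using assms by induction (auto simp: function_convex_def)

lemma tail_average_measurable:
  assumes "A \<in> tail_averages n" and [measurable]: "\<And>j. f j \<in> borel_measurable M"
  shows "(\<lambda>x. A (\<lambda>j. f j x)) \<in> borel_measurable M"
  using assms(1) by induction simp_all

lemma tail_average_integral:
  assumes "A \<in> tail_averages n" and "\<And>j. integrable M (f j)"
  shows "integrable M (\<lambda>x. A (\<lambda>j. f j x)) \<and>
    (\<integral>x. A (\<lambda>j. f j x) \<partial>M) = A (\<lambda>j. \<integral>x. f j x \<partial>M)"
  using assms by induction simp_all

lemma tail_averages_tendsto:
  assumes A: "\<And>n. A n \<in> tail_averages n" and s: "s \<longlonglongrightarrow> l"
  shows "(\<lambda>n. A n s) \<longlonglongrightarrow> l"
proof (rule LIMSEQ_I)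
  fix e :: real assume "0 < e"
  then obtain N where N: "\<And>j. N \<le> j \<Longrightarrow> \<bar>s j - l\<bar> < e/2"
    using LIMSEQ_D[OF s, of "e/2"] by auto
  have "\<bar>A n s - l\<bar> \<le> e/2" if "N \<le> n" for n
  proof -
    have "A n s \<le> A n (\<lambda>_. l + e/2)"
    proof (rule tail_average_mono[OF A])
      fix j assume "n \<le> j" then show "s j \<le> l + e/2" using N[of j] that by linarith
    qed
    moreover have "A n (\<lambda>_. l - e/2) \<le> A n s"
    proof (rule tail_average_mono[OF A])
      fix j assume "n \<le> j" then show "l - e/2 \<le> s j" using N[of j] that by linarith
    qed
    ultimately show ?thesis unfolding tail_average_const[OF A] by linarith
  qed
  then have "\<forall>n\<ge>N. norm (A n s - l) < e" using \<open>0 < e\<close> by fastforce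
  then show "\<exists>N. \<forall>n\<ge>N. norm (A n s - l) < e" ..
qed

text \<open>
  The parallelogram identity behind the compactness argument: it measures by a square how strictly
  convex \<open>exp (- x)\<close> is between \<^term>\<open>a\<close> and \<^term>\<open>b\<close>, and
  unlike the one for \<open>x\<^sup>2\<close> it asks for no integrability.
\<close>

lemma exp_midpoint_defect:
  fixes a b :: real
  shows "(exp (- a / 2) - exp (- b / 2))\<^sup>2
    = exp (- a) + exp (- b) - 2 * exp (- (a / 2 + b / 2))"
proof -
  have "exp (- a) = (exp (- a / 2))\<^sup>2" "exp (- b) = (exp (- b / 2))\<^sup>2"
       "exp (- (a / 2 + b / 2)) = exp (- a / 2) * exp (- b / 2)"
    by (simp_all flip: exp_double exp_add)
  then show ?thesis by (simp add: power2_diff algebra_simps)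
qed

text \<open>
  Choose averages of the tails that nearly minimise \<open>E[exp (- g)]\<close>. Since the midpoint of two of
  them is again an average of a tail, it cannot do much better, and the midpoint identity makes
  \<open>exp (- g / 2)\<close> Cauchy in the mean along the sequence, hence almost surely along a subsequence.
\<close>

lemma tail_averages_exp_Cauchy:
  fixes f :: "nat \<Rightarrow> 'a \<Rightarrow> real"
  assumes "prob_space M"
    and f[measurable]: "\<And>j. f j \<in> borel_measurable M" and f0: "\<And>j x. 0 \<le> f j x"
  obtains A where "\<And>n. A n \<in> tail_averages n"
    "AE x in M. convergent (\<lambda>n. exp (- A n (\<lambda>j. f j x) / 2))"
proof -
  interpret prob_space M by fact
  define \<Phi> :: "((nat \<Rightarrow> real) \<Rightarrow> real) \<Rightarrow> real"
    where "\<Phi> A = (\<integral>x. exp (- A (\<lambda>j. f j x)) \<partial>M)" for A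
  have nn: "0 \<le> A (\<lambda>j. f j x)" if "A \<in> tail_averages n" for A n x
    using tail_average_mono[OF that, of "\<lambda>_. 0" "\<lambda>j. f j x"] f0
    by (simp add: tail_average_const[OF that])
  have meas: "(\<lambda>x. A (\<lambda>j. f j x)) \<in> borel_measurable M" if "A \<in> tail_averages n" for A n
    by (rule tail_average_measurable[OF that]) simp
  have int: "integrable M (\<lambda>x. exp (- A (\<lambda>j. f j x) / c))" if "A \<in> tail_averages n" "c > 0" for A n c
    by (rule integrable_const_bound[of _ 1]) (use nn[OF that(1)] meas[OF that(1)] that in auto)
  have int1: "integrable M (\<lambda>x. exp (- A (\<lambda>j. f j x)))" if "A \<in> tail_averages n" for A n
    using int[OF that, of 1] by simp
  have \<Phi>0: "0 \<le> \<Phi> A" for A unfolding \<Phi>_def by simp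
  define d where "d n = (INF A\<in>tail_averages n. \<Phi> A)" for n
  have bdd: "bdd_below (\<Phi> ` tail_averages n)" for n using \<Phi>0 by (auto intro!: bdd_belowI)
  have ne: "tail_averages n \<noteq> {}" for n using tail_averages.point[of n n] by blast
  have d_le: "d n \<le> \<Phi> A" if "A \<in> tail_averages n" for A n
    unfolding d_def by (rule cINF_lower[OF bdd that])
  have d_mono: "d n \<le> d m" if "n \<le> m" for n m
    unfolding d_def[of m] by (rule cINF_greatest[OF ne]) (use d_le tail_averages_mono that in blast)
  have d_bound: "d n \<le> 1" for n
  proof -
    have e: "(\<lambda>s. s n) \<in> tail_averages n" by (simp add: tail_averages.point)
    have "\<Phi> (\<lambda>s. s n) \<le> (\<integral>x. 1 \<partial>M)"
      unfolding \<Phi>_def by (rule integral_mono[OF int1[OF e]]) (use f0 in auto)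
    then show ?thesis using d_le[OF e] by (simp add: prob_space)
  qed
  have "\<exists>A\<in>tail_averages n. \<Phi> A < d n + (1/2)^n" for n
    using cINF_less_iff[OF ne bdd, of n "d n + (1/2)^n"] unfolding d_def by simp
  then obtain A where A: "\<And>n. A n \<in> tail_averages n" and A\<Phi>: "\<And>n. \<Phi> (A n) < d n + (1/2)^n"
    by metis
  obtain D where D: "d \<longlonglongrightarrow> D" "\<And>n. d n \<le> D"
  proof -
    have bd: "bdd_above (range d)" using d_bound by (auto intro!: bdd_aboveI)
    have "incseq d" using d_mono by (auto simp: incseq_def)
    from LIMSEQ_incseq_SUP[OF bd this] show ?thesis
      by (rule that) (rule cSUP_upper[OF UNIV_I bd])
  qed
  define h where "h n x = exp (- A n (\<lambda>j. f j x) / 2)" for n x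
  have h_int: "integrable M (h n)" for n unfolding h_def by (rule int[OF A]) simp
  have h01: "0 \<le> h n x" "h n x \<le> 1" for n x unfolding h_def using nn[OF A] by auto
  \<comment> \<open>d is almost constant far out, so two near-minimisers have a near-minimal midpoint.\<close>
  have sq: "(\<integral>x. (h n x - h m x)\<^sup>2 \<partial>M) \<le> 2 * (1/2)^n + (D - d n)" if "n \<le> m" for n m
  proof -
    define B where "B = (\<lambda>s. 1/2 * A n s + (1 - 1/2) * A m s)"
    have B: "B \<in> tail_averages n" unfolding B_def
      by (rule tail_averages.mix[OF A tail_averages_mono[OF A that]]) auto
    have "(\<integral>x. (h n x - h m x)\<^sup>2 \<partial>M)
      = (\<integral>x. exp (- A n (\<lambda>j. f j x)) + exp (- A m (\<lambda>j. f j x)) - 2 * exp (- B (\<lambda>j. f j x)) \<partial>M)"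
      unfolding h_def exp_midpoint_defect B_def by (simp add: field_simps)
    also have "\<dots> = \<Phi> (A n) + \<Phi> (A m) - 2 * \<Phi> B"
      unfolding \<Phi>_def using int1[OF A] int1[OF B] by simp
    also have "\<dots> \<le> (d n + (1/2)^n) + (D + (1/2)^n) - 2 * d n"
    proof -
      have "(1/2::real)^m \<le> (1/2)^n" using that by (intro power_decreasing) auto
      then show ?thesis using A\<Phi>[of n] A\<Phi>[of m] D(2)[of m] d_le[OF B] by linarith
    qed
    finally show ?thesis by simp
  qed
  have lim: "(\<lambda>n. 2 * (1/2)^n + (D - d n)) \<longlonglongrightarrow> 2 * 0 + (D - D)"
    by (intro tendsto_intros D LIMSEQ_power_zero) auto
  have sq_int: "integrable M (\<lambda>x. (h n x - h m x)\<^sup>2)" for n m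
  proof (rule integrable_const_bound[of _ 1])
    show "AE x in M. norm ((h n x - h m x)\<^sup>2) \<le> 1"
    proof (intro AE_I2)
      fix x have "\<bar>h n x - h m x\<bar> \<le> 1" using h01[of n x] h01[of m x] by linarith
      then show "norm ((h n x - h m x)\<^sup>2) \<le> 1" by (simp add: abs_square_le_1)
    qed
  qed (use h_int in measurable)
  obtain r where r: "strict_mono r" and rC: "AE x in M. Cauchy (\<lambda>i. h (r i) x)"
  proof (rule cauchy_L1_AE_cauchy_subseq[of M h, OF h_int])
    fix e :: real assume e: "e > 0"
    then have "eventually (\<lambda>n. 2 * (1/2)^n + (D - d n) < e\<^sup>2) sequentially"
      using lim by (intro order_tendstoD(2)) auto
    then obtain N where N: "\<And>n. N \<le> n \<Longrightarrow> 2 * (1/2)^n + (D - d n) < e\<^sup>2"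
      by (auto simp: eventually_sequentially)
    have *: "(LINT x|M. norm (h i x - h j x)) < e" if "N \<le> i" "i \<le> j" for i j
    proof -
      \<comment> \<open>The elementary inequality y <= e/2 + y^2/(2e) turns the bound on squares into one on the mean.\<close>
      have "(LINT x|M. norm (h i x - h j x)) \<le> (LINT x|M. e/2 + (h i x - h j x)\<^sup>2 / (2*e))"
      proof (rule integral_mono)
        fix x
        have "0 \<le> (e - \<bar>h i x - h j x\<bar>)\<^sup>2" by simp
        then have "2 * e * \<bar>h i x - h j x\<bar> \<le> e*e + (h i x - h j x)\<^sup>2"
          by (simp add: power2_diff power2_eq_square algebra_simps)
        then show "norm (h i x - h j x) \<le> e/2 + (h i x - h j x)\<^sup>2 / (2*e)"
          using e by (simp add: field_simps)
      qed (use h_int sq_int in auto)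
      also have "\<dots> = e/2 + (LINT x|M. (h i x - h j x)\<^sup>2) / (2*e)"
        using sq_int by (simp add: prob_space)
      also have "\<dots> < e/2 + e\<^sup>2/(2*e)"
        using sq[OF that(2)] N[OF that(1)] e by (simp add: divide_strict_right_mono)
      finally show ?thesis using e by (simp add: power2_eq_square)
    qed
    show "\<exists>N. \<forall>i\<ge>N. \<forall>j\<ge>N. LINT x|M. norm (h i x - h j x) < e"
    proof (intro exI[of _ N] allI impI)
      fix i j assume "N \<le> i" "N \<le> j"
      then show "LINT x|M. norm (h i x - h j x) < e"
        using *[of i j] *[of j i] by (cases "i \<le> j") (auto simp: abs_minus_commute)
    qed
  qed auto
  show ?thesis
  proof (rule that[of "\<lambda>k. A (r k)"])
    show "A (r n) \<in> tail_averages n" for n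
      by (rule tail_averages_mono[OF A]) (rule seq_suble[OF r])
    show "AE x in M. convergent (\<lambda>n. exp (- A (r n) (\<lambda>j. f j x) / 2))"
      using rC by eventually_elim (simp add: h_def Cauchy_convergent_iff)
  qed
qed

text \<open>
  Komlos' theorem in the form with forward convex combinations. The averages converge in
  \<open>[0, \<infinity>]\<close> by the preceding lemma, and Fatou's lemma with the bound on the means rules out
  the value \<open>\<infinity>\<close>.
\<close>

lemma tail_averages_AE_convergent:
  fixes f :: "nat \<Rightarrow> 'a \<Rightarrow> real"
  assumes "prob_space M"
    and f: "\<And>j. integrable M (f j)" and f0: "\<And>j x. 0 \<le> f j x"
    and bnd: "\<And>j. (\<integral>x. f j x \<partial>M) \<le> K"
  obtains A where "\<And>n. A n \<in> tail_averages n"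
    "AE x in M. convergent (\<lambda>n. A n (\<lambda>j. f j x))"
proof -
  have fm: "\<And>j. f j \<in> borel_measurable M" using f by blast
  obtain A where A: "\<And>n. A n \<in> tail_averages n"
    and c: "AE x in M. convergent (\<lambda>n. exp (- A n (\<lambda>j. f j x) / 2))"
    using tail_averages_exp_Cauchy[where f = f, OF assms(1) fm f0] by blast
  define g where "g n x = A n (\<lambda>j. f j x)" for n x
  have g_int: "integrable M (g n)" for n
    unfolding g_def using tail_average_integral[where f = f, OF A f] by blast
  have g_bnd: "(\<integral>x. g n x \<partial>M) \<le> K" for n
  proof -
    have "(\<integral>x. g n x \<partial>M) = A n (\<lambda>j. \<integral>x. f j x \<partial>M)"
      unfolding g_def using tail_average_integral[where f = f, OF A f] by blast
    also have "\<dots> \<le> A n (\<lambda>_. K)" by (rule tail_average_mono[OF A bnd])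
    finally show ?thesis unfolding tail_average_const[OF A] .
  qed
  have [measurable]: "g n \<in> borel_measurable M" for n using g_int by blast
  have g0: "0 \<le> g n x" for n x
    using tail_average_mono[OF A, of n "\<lambda>_. 0" "\<lambda>j. f j x"] f0
    by (simp add: tail_average_const[OF A] g_def)
  have "(\<integral>\<^sup>+x. liminf (\<lambda>n. ennreal (g n x)) \<partial>M) \<le> liminf (\<lambda>n. \<integral>\<^sup>+x. ennreal (g n x) \<partial>M)"
    by (rule nn_integral_liminf) measurable
  also have "\<dots> \<le> ennreal K"
    by (intro Liminf_le always_eventually)
      (auto simp: nn_integral_eq_integral[OF g_int] g0 g_bnd intro!: ennreal_leI)
  finally have "(\<integral>\<^sup>+x. liminf (\<lambda>n. ennreal (g n x)) \<partial>M) \<noteq> \<infinity>" by (auto simp: top_unique)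
  then have fin: "AE x in M. liminf (\<lambda>n. ennreal (g n x)) \<noteq> \<infinity>"
    by (intro nn_integral_PInf_AE) measurable
  have "AE x in M. convergent (\<lambda>n. g n x)"
    using c fin
  proof eventually_elim
    case (elim x)
    then obtain l where l: "(\<lambda>n. exp (- g n x / 2)) \<longlonglongrightarrow> l" by (auto simp: convergent_def g_def)
    have "0 \<le> l" by (rule LIMSEQ_le_const[OF l]) auto
    show ?case
    proof (cases "l = 0")
      case True
      then have "filterlim (\<lambda>n. exp (- g n x / 2)) (at_right 0) sequentially"
        using l by (simp add: filterlim_at)
      then have "filterlim (\<lambda>n. ln (exp (- g n x / 2))) at_bot sequentially"
        by (rule filterlim_compose[OF ln_at_0])
      then have *: "filterlim (\<lambda>n. - g n x / 2) at_bot sequentially" by simp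
      have "(\<lambda>n. ennreal (g n x)) \<longlonglongrightarrow> \<infinity>"
        unfolding tendsto_PInfty_eq_at_top[symmetric] infinity_ennreal_def
      proof (subst ennreal_tendsto_top_eq_at_top, unfold filterlim_at_top, intro allI)
        fix Z
        show "\<forall>\<^sub>F n in sequentially. Z \<le> g n x"
          using *[unfolded filterlim_at_bot, rule_format, of "-Z/2"] by eventually_elim simp
      qed
      then have "liminf (\<lambda>n. ennreal (g n x)) = \<infinity>"
        by (intro lim_imp_Liminf) auto
      then show ?thesis using elim by simp
    next
      case False
      then have "(\<lambda>n. - 2 * ln (exp (- g n x / 2))) \<longlonglongrightarrow> - 2 * ln l"
        using l \<open>0 \<le> l\<close> by (intro tendsto_intros) auto
      then show ?thesis by (auto simp: convergent_def)
    qed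
  qed
  then show ?thesis using that[OF A] unfolding g_def by blast
qed

section \<open>The Hahn-Banach theorem for spaces of functions\<close>

definition function_subspace :: "('a \<Rightarrow> real) set \<Rightarrow> bool" where
  "function_subspace L \<longleftrightarrow> (\<lambda>_. 0) \<in> L \<and>
     (\<forall>f\<in>L. \<forall>g\<in>L. (\<lambda>x. f x + g x) \<in> L) \<and> (\<forall>f\<in>L. \<forall>c. (\<lambda>x. c * f x) \<in> L)"

definition sublinear_on :: "('a \<Rightarrow> real) set \<Rightarrow> (('a \<Rightarrow> real) \<Rightarrow> real) \<Rightarrow> bool" where
  "sublinear_on L q \<longleftrightarrow>
     (\<forall>f\<in>L. \<forall>g\<in>L. q (\<lambda>x. f x + g x) \<le> q f + q g) \<and>
     (\<forall>f\<in>L. \<forall>c\<ge>0. q (\<lambda>x. c * f x) = c * q f)"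

lemma function_subspaceD:
  assumes "function_subspace L" "f \<in> L"
  shows "g \<in> L \<Longrightarrow> (\<lambda>x. f x + g x) \<in> L" "(\<lambda>x. c * f x) \<in> L" "(\<lambda>x. - f x) \<in> L"
proof -
  show sc: "(\<lambda>x. c * f x) \<in> L" for c using assms unfolding function_subspace_def by simp
  show "(\<lambda>x. - f x) \<in> L" using sc[of "-1"] by simp
  show "g \<in> L \<Longrightarrow> (\<lambda>x. f x + g x) \<in> L" using assms unfolding function_subspace_def by simp
qed

lemma sublinear_onD:
  assumes "sublinear_on L q" "f \<in> L"
  shows "g \<in> L \<Longrightarrow> q (\<lambda>x. f x + g x) \<le> q f + q g" "0 \<le> c \<Longrightarrow> q (\<lambda>x. c * f x) = c * q f"
  using assms unfolding sublinear_on_def by simp_all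

lemma sublinear_on_zero:
  assumes "function_subspace L" "sublinear_on L q" shows "q (\<lambda>_. 0) = 0"
  using assms unfolding function_subspace_def sublinear_on_def by force

lemma sublinear_on_neg:
  assumes L: "function_subspace L" and q: "sublinear_on L q" and f: "f \<in> L"
  shows "- q (\<lambda>x. - f x) \<le> q f"
proof -
  have "q (\<lambda>x. f x + - f x) \<le> q f + q (\<lambda>x. - f x)"
    by (rule sublinear_onD(1)[OF q f function_subspaceD(3)[OF L f]])
  then show ?thesis using sublinear_on_zero[OF L q] by simp
qed

text \<open>
  Zorn's lemma: along a chain the pointwise infimum is bounded below by \<open>- p (- f)\<close>, and it is
  again sublinear because the chain is totally ordered.
\<close>

lemma minimal_sublinear_exists:
  assumes L: "function_subspace L" and p: "sublinear_on L p"
  obtains q where "sublinear_on L q" "\<And>f. f \<in> L \<Longrightarrow> q f \<le> p f"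
    "\<And>r f. sublinear_on L r \<Longrightarrow> (\<And>g. g \<in> L \<Longrightarrow> r g \<le> q g) \<Longrightarrow> f \<in> L \<Longrightarrow> r f = q f"
proof -
  \<comment> \<open>Functionals are normalised to 0 outside L, which makes the pointwise order antisymmetric.\<close>
  define \<Q> where "\<Q> = {q. sublinear_on L q \<and> (\<forall>f\<in>L. q f \<le> p f) \<and> (\<forall>f. f \<notin> L \<longrightarrow> q f = 0)}"
  define below where "below = (\<lambda>(a::('a \<Rightarrow> real) \<Rightarrow> real) b. b \<le> a)"
  define cut where "cut r = (\<lambda>f. if f \<in> L then r f else 0)" for r :: "('a \<Rightarrow> real) \<Rightarrow> real"
  have clos: "(\<lambda>x. f x + g x) \<in> L" "(\<lambda>x. c * f x) \<in> L" "(\<lambda>x. - f x) \<in> L"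
    if "f \<in> L" "g \<in> L" for f g c
    using function_subspaceD[OF L that(1)] that(2) by auto
  have cut_sub: "sublinear_on L (cut r)" if "sublinear_on L r" for r
    using that clos unfolding sublinear_on_def cut_def by simp
  have "\<exists>m\<in>\<Q>. \<forall>a\<in>\<Q>. below m a \<longrightarrow> a = m"
  proof (rule predicate_Zorn)
    show "partial_order_on \<Q> (relation_of below \<Q>)"
      unfolding below_def by (rule partial_order_on_relation_ofI) auto
  next
    fix C assume C: "C \<in> Chains (relation_of below \<Q>)"
    then have CQ: "C \<subseteq> \<Q>" and ch: "\<And>a b. a \<in> C \<Longrightarrow> b \<in> C \<Longrightarrow> a \<le> b \<or> b \<le> a"
      unfolding Chains_def relation_of_def below_def by auto
    show "\<exists>u\<in>\<Q>. \<forall>a\<in>C. below a u"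
    proof (cases "C = {}")
      case True
      have "cut p \<in> \<Q>" using cut_sub[OF p] unfolding \<Q>_def by (auto simp: cut_def)
      then show ?thesis using True by blast
    next
      case False
      define u where "u = cut (\<lambda>f. INF q\<in>C. q f)"
      have sub: "sublinear_on L q" and le_p: "f \<in> L \<Longrightarrow> q f \<le> p f" if "q \<in> C" for q f
        using that CQ unfolding \<Q>_def by auto
      have bdd: "bdd_below ((\<lambda>q. q f) ` C)" if f: "f \<in> L" for f
      proof (intro bdd_belowI2)
        fix q assume q: "q \<in> C"
        have "- p (\<lambda>x. - f x) \<le> - q (\<lambda>x. - f x)" using le_p[OF q clos(3)[OF f f]] by simp
        also have "\<dots> \<le> q f" by (rule sublinear_on_neg[OF L sub[OF q] f])
        finally show "- p (\<lambda>x. - f x) \<le> q f" .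
      qed
      have u_le: "u f \<le> q f" if "f \<in> L" "q \<in> C" for f q
        unfolding u_def cut_def using that cINF_lower[OF bdd that(2)] by simp
      have u_ge: "b \<le> u f" if "f \<in> L" "\<And>q. q \<in> C \<Longrightarrow> b \<le> q f" for f b
        unfolding u_def cut_def using that cINF_greatest[OF False, of b "\<lambda>q. q f"] by simp
      have "sublinear_on L u"
        unfolding sublinear_on_def
      proof (intro conjI ballI allI impI)
        fix f g assume f: "f \<in> L" and g: "g \<in> L"
        \<comment> \<open>Of two members of the chain the smaller one serves for both summands.\<close>
        have *: "u (\<lambda>x. f x + g x) \<le> q1 f + q2 g" if q: "q1 \<in> C" "q2 \<in> C" for q1 q2
        proof -
          obtain q where "q \<in> C" "q \<le> q1" "q \<le> q2" using ch[OF q] q by (metis order_refl)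
          have "u (\<lambda>x. f x + g x) \<le> q (\<lambda>x. f x + g x)" by (rule u_le[OF clos(1)[OF f g] \<open>q \<in> C\<close>])
          also have "\<dots> \<le> q f + q g"
            by (rule sublinear_onD(1)[OF sub[OF \<open>q \<in> C\<close>] f g])
          also have "\<dots> \<le> q1 f + q2 g"
            by (rule add_mono[OF le_funD[OF \<open>q \<le> q1\<close>] le_funD[OF \<open>q \<le> q2\<close>]])
          finally show ?thesis .
        qed
        have "u (\<lambda>x. f x + g x) - q2 g \<le> u f" if "q2 \<in> C" for q2
        proof (rule u_ge[OF f])
          fix q assume "q \<in> C"
          from *[OF this that] show "u (\<lambda>x. f x + g x) - q2 g \<le> q f" by linarith
        qed
        then have "u (\<lambda>x. f x + g x) - u f \<le> q2 g" if "q2 \<in> C" for q2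
          using that by force
        then have "u (\<lambda>x. f x + g x) - u f \<le> u g" by (rule u_ge[OF g])
        then show "u (\<lambda>x. f x + g x) \<le> u f + u g" by simp
      next
        fix f and c :: real assume f: "f \<in> L" and c: "0 \<le> c"
        have eq: "q (\<lambda>x. c * f x) = c * q f" if "q \<in> C" for q
          by (rule sublinear_onD(2)[OF sub[OF that] f c])
        obtain q0 where q0: "q0 \<in> C" using False by blast
        show "u (\<lambda>x. c * f x) = c * u f"
        proof (cases "c = 0")
          case True
          have "u (\<lambda>_. 0) = 0"
          proof (rule antisym)
            have z: "(\<lambda>_. 0) \<in> L" using L unfolding function_subspace_def by blast
            show "u (\<lambda>_. 0) \<le> 0" using u_le[OF z q0] sublinear_on_zero[OF L sub[OF q0]] by simp
            show "0 \<le> u (\<lambda>_. 0)" by (rule u_ge[OF z]) (simp add: sublinear_on_zero[OF L sub])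
          qed
          then show ?thesis using True by simp
        next
          case False
          then have c: "c > 0" using c by simp
          show ?thesis
          proof (rule antisym)
            have "u (\<lambda>x. c * f x) / c \<le> u f"
            proof (rule u_ge[OF f])
              fix q assume q: "q \<in> C"
              show "u (\<lambda>x. c * f x) / c \<le> q f"
                using u_le[OF clos(2)[OF f f] q, of c] eq[OF q] c by (simp add: field_simps)
            qed
            then show "u (\<lambda>x. c * f x) \<le> c * u f" using c by (simp add: field_simps)
            show "c * u f \<le> u (\<lambda>x. c * f x)"
            proof (rule u_ge[OF clos(2)[OF f f]])
              fix q assume q: "q \<in> C"
              show "c * u f \<le> q (\<lambda>x. c * f x)"
                unfolding eq[OF q] using u_le[OF f q] c by (intro mult_left_mono) auto
            qed
          qed
        qed
      qed
      moreover have "u f \<le> p f" if "f \<in> L" for f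
        using False u_le[OF that] le_p[OF _ that] by (meson ex_in_conv order_trans)
      ultimately have "u \<in> \<Q>" unfolding \<Q>_def by (auto simp: u_def cut_def)
      moreover have "u \<le> a" if "a \<in> C" for a
      proof (rule le_funI)
        fix f show "u f \<le> a f"
        proof (cases "f \<in> L")
          case False
          moreover have "a f = 0" using False that CQ unfolding \<Q>_def by auto
          ultimately show ?thesis by (simp add: u_def cut_def)
        qed (use u_le that in auto)
      qed
      ultimately show ?thesis unfolding below_def by blast
    qed
  qed
  then obtain q where q: "q \<in> \<Q>" and min: "\<And>a. a \<in> \<Q> \<Longrightarrow> a \<le> q \<Longrightarrow> a = q"
    unfolding below_def by blast
  show ?thesis
  proof (rule that)
    show "sublinear_on L q" "\<And>f. f \<in> L \<Longrightarrow> q f \<le> p f" using q unfolding \<Q>_def by auto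
    fix r f assume r: "sublinear_on L r" "\<And>g. g \<in> L \<Longrightarrow> r g \<le> q g" and f: "f \<in> L"
    have "cut r \<in> \<Q>" using q r cut_sub[OF r(1)] unfolding \<Q>_def cut_def by fastforce
    moreover have "cut r \<le> q" using q r(2) unfolding \<Q>_def cut_def le_fun_def by auto
    ultimately have "cut r = q" by (rule min)
    then show "r f = q f" using f by (auto simp: cut_def)
  qed
qed

text \<open>
  A minimal sublinear functional is linear. Minimising \<open>q (g + t f) - t q f\<close> over \<open>t \<ge> 0\<close> gives a
  smaller sublinear functional \<open>r\<close> of \<open>g\<close> with \<open>r (- f) \<le> - q f\<close>; minimality forces \<open>q (- f) = - q f\<close>, and a
  sublinear functional that is odd is linear.
\<close>

lemma Hahn_Banach_sublinear:
  assumes L: "function_subspace L" and p: "sublinear_on L p"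
  obtains l where "\<And>f g. f \<in> L \<Longrightarrow> g \<in> L \<Longrightarrow> l (\<lambda>x. f x + g x) = l f + l g"
    "\<And>f c. f \<in> L \<Longrightarrow> l (\<lambda>x. c * f x) = c * l f"
    "\<And>f. f \<in> L \<Longrightarrow> l f \<le> p f"
proof -
  obtain q where q: "sublinear_on L q" and qp: "\<And>f. f \<in> L \<Longrightarrow> q f \<le> p f"
    and min: "\<And>r f. sublinear_on L r \<Longrightarrow> (\<And>g. g \<in> L \<Longrightarrow> r g \<le> q g) \<Longrightarrow> f \<in> L \<Longrightarrow> r f = q f"
    using minimal_sublinear_exists[OF L p] by blast
  note add = function_subspaceD(1)[OF L] and scale = function_subspaceD(2)[OF L]
    and neg = function_subspaceD(3)[OF L]
    and q_add = sublinear_onD(1)[OF q] and q_scale = sublinear_onD(2)[OF q]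
  have odd: "q (\<lambda>x. - f x) = - q f" if f: "f \<in> L" for f
  proof -
    have tf: "(\<lambda>x. g x + t * f x) \<in> L" if "g \<in> L" for g t using add[OF that scale[OF f]] .
    \<comment> \<open>The largest functional below q that is additive in the direction f.\<close>
    define r where "r g = (INF t\<in>{0..}. q (\<lambda>x. g x + t * f x) - t * q f)" for g
    have lower: "- q (\<lambda>x. - g x) \<le> q (\<lambda>x. g x + t * f x) - t * q f" if g: "g \<in> L" and t: "0 \<le> t" for g t
    proof -
      have "q (\<lambda>x. (g x + t * f x) + (- g x)) \<le> q (\<lambda>x. g x + t * f x) + q (\<lambda>x. - g x)"
        by (rule q_add[OF tf[OF g] neg[OF g]])
      then show ?thesis using q_scale[OF f t] by simp
    qed
    have bdd: "bdd_below ((\<lambda>t. q (\<lambda>x. g x + t * f x) - t * q f) ` {0..})" if "g \<in> L" for g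
      by (rule bdd_belowI2) (use lower[OF that] in auto)
    have r_le: "r g \<le> q (\<lambda>x. g x + t * f x) - t * q f" if "g \<in> L" "0 \<le> t" for g t
      unfolding r_def by (rule cINF_lower[OF bdd]) (use that in auto)
    have r_ge: "b \<le> r g" if "\<And>t. 0 \<le> t \<Longrightarrow> b \<le> q (\<lambda>x. g x + t * f x) - t * q f" for g b
      unfolding r_def by (rule cINF_greatest) (use that in auto)
    have "sublinear_on L r"
      unfolding sublinear_on_def
    proof (intro conjI ballI allI impI)
      fix g h assume g: "g \<in> L" and h: "h \<in> L"
      have *: "r (\<lambda>x. g x + h x) \<le> (q (\<lambda>x. g x + s * f x) - s * q f) + (q (\<lambda>x. h x + t * f x) - t * q f)"
        if "0 \<le> s" "0 \<le> t" for s t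
      proof -
        have "r (\<lambda>x. g x + h x) \<le> q (\<lambda>x. (g x + h x) + (s + t) * f x) - (s + t) * q f"
          by (rule r_le[OF add[OF g h]]) (use that in auto)
        also have "(\<lambda>x. (g x + h x) + (s + t) * f x) = (\<lambda>x. (g x + s * f x) + (h x + t * f x))"
          by (auto simp: algebra_simps)
        also have "q \<dots> \<le> q (\<lambda>x. g x + s * f x) + q (\<lambda>x. h x + t * f x)"
          by (rule q_add[OF tf[OF g] tf[OF h]])
        finally show ?thesis by (simp add: algebra_simps)
      qed
      have **: "r (\<lambda>x. g x + h x) - (q (\<lambda>x. h x + t * f x) - t * q f) \<le> r g" if "0 \<le> t" for t
      proof (rule r_ge)
        fix s :: real assume "0 \<le> s"
        from *[OF this that]
        show "r (\<lambda>x. g x + h x) - (q (\<lambda>x. h x + t * f x) - t * q f) \<le> q (\<lambda>x. g x + s * f x) - s * q f"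
          by linarith
      qed
      have "r (\<lambda>x. g x + h x) - r g \<le> q (\<lambda>x. h x + t * f x) - t * q f" if "0 \<le> t" for t
        using **[OF that] by linarith
      then have "r (\<lambda>x. g x + h x) - r g \<le> r h" by (rule r_ge)
      then show "r (\<lambda>x. g x + h x) \<le> r g + r h" by simp
    next
      fix g and c :: real assume g: "g \<in> L" and c: "0 \<le> c"
      show "r (\<lambda>x. c * g x) = c * r g"
      proof (cases "c = 0")
        case True
        have "(\<lambda>t. q (\<lambda>x. t * f x) - t * q f) ` {0..} = {0}" using q_scale[OF f] by force
        then show ?thesis using True by (simp add: r_def)
      next
        case False
        then have c: "c > 0" using c by simp
        have eq: "q (\<lambda>x. c * g x + (c * t) * f x) = c * q (\<lambda>x. g x + t * f x)" for t
          using q_scale[OF tf[OF g], of c t] c by (simp add: algebra_simps)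
        show ?thesis
        proof (rule antisym)
          have "r (\<lambda>x. c * g x) / c \<le> r g"
          proof (rule r_ge)
            fix t :: real assume "0 \<le> t"
            then have "r (\<lambda>x. c * g x) \<le> q (\<lambda>x. c * g x + (c * t) * f x) - (c * t) * q f"
              using c by (intro r_le[OF scale[OF g]]) auto
            also have "\<dots> = c * (q (\<lambda>x. g x + t * f x) - t * q f)"
              unfolding eq by (simp add: algebra_simps)
            finally show "r (\<lambda>x. c * g x) / c \<le> q (\<lambda>x. g x + t * f x) - t * q f"
              using c by (simp add: field_simps)
          qed
          then show "r (\<lambda>x. c * g x) \<le> c * r g" using c by (simp add: field_simps)
          show "c * r g \<le> r (\<lambda>x. c * g x)"
          proof (rule r_ge)
            fix t :: real assume "0 \<le> t"
            then have "c * r g \<le> c * (q (\<lambda>x. g x + (t/c) * f x) - (t/c) * q f)"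
              using c by (intro mult_left_mono r_le[OF g]) auto
            also have "\<dots> = q (\<lambda>x. c * g x + t * f x) - t * q f"
              using eq[of "t/c"] c by (simp add: algebra_simps)
            finally show "c * r g \<le> q (\<lambda>x. c * g x + t * f x) - t * q f" .
          qed
        qed
      qed
    qed
    moreover have "r g \<le> q g" if "g \<in> L" for g using r_le[OF that, of 0] by simp
    ultimately have "r (\<lambda>x. - f x) = q (\<lambda>x. - f x)" using min neg[OF f] by blast
    moreover have "r (\<lambda>x. - f x) \<le> - q f"
      using r_le[OF neg[OF f], of 1] sublinear_on_zero[OF L q] by simp
    ultimately show ?thesis using sublinear_on_neg[OF L q f] by simp
  qed
  show ?thesis
  proof (rule that[of q])
    fix f g assume f: "f \<in> L" and g: "g \<in> L"
    have "q (\<lambda>x. - f x + - g x) \<le> q (\<lambda>x. - f x) + q (\<lambda>x. - g x)"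
      by (rule q_add[OF neg[OF f] neg[OF g]])
    then have "- q (\<lambda>x. f x + g x) \<le> - q f - q g"
      using odd[OF f] odd[OF g] odd[OF add[OF f g]] by (simp add: algebra_simps)
    then show "q (\<lambda>x. f x + g x) = q f + q g" using q_add[OF f g] by simp
  next
    fix f and c :: real assume f: "f \<in> L"
    show "q (\<lambda>x. c * f x) = c * q f"
    proof (cases "0 \<le> c")
      case False
      then have "q (\<lambda>x. (-c) * (- f x)) = (-c) * q (\<lambda>x. - f x)"
        by (intro q_scale[OF neg[OF f]]) simp
      then show ?thesis using odd[OF f] by simp
    qed (use q_scale[OF f] in auto)
  qed (use qp in auto)
qed

section \<open>Convex expectations and the Fatou property\<close>

lemma Linf_bounded:
  assumes "f \<in> Linf \<mu>" obtains C where "AE x in \<mu>. \<bar>f x\<bar> \<le> C"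
  using assms unfolding Linf_def by auto

lemma Linf_subspace: "function_subspace (Linf \<mu>)"
proof -
  have "(\<lambda>x. f x + g x) \<in> Linf \<mu>" if fg: "f \<in> Linf \<mu>" "g \<in> Linf \<mu>" for f g
  proof -
    obtain C where C: "AE x in \<mu>. \<bar>f x\<bar> \<le> C" using Linf_bounded[OF fg(1)] .
    obtain D where D: "AE x in \<mu>. \<bar>g x\<bar> \<le> D" using Linf_bounded[OF fg(2)] .
    from C D have "AE x in \<mu>. \<bar>f x + g x\<bar> \<le> C + D" by eventually_elim linarith
    then show ?thesis using that unfolding Linf_def by auto
  qed
  moreover have "(\<lambda>x. c * f x) \<in> Linf \<mu>" if f: "f \<in> Linf \<mu>" for f c
  proof -
    obtain C where "AE x in \<mu>. \<bar>f x\<bar> \<le> C" using Linf_bounded[OF f] .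
    then have "AE x in \<mu>. \<bar>c * f x\<bar> \<le> \<bar>c\<bar> * C"
      by eventually_elim (auto simp: abs_mult intro: mult_left_mono)
    then show ?thesis using that unfolding Linf_def by auto
  qed
  ultimately show ?thesis unfolding function_subspace_def by (auto simp: Linf_def)
qed

lemma Linf_const: "(\<lambda>_. c) \<in> Linf \<mu>"
  unfolding Linf_def by (auto intro: exI[of _ "\<bar>c\<bar>"])

lemma Linf_add: "f \<in> Linf \<mu> \<Longrightarrow> g \<in> Linf \<mu> \<Longrightarrow> (\<lambda>x. f x + g x) \<in> Linf \<mu>"
  by (rule function_subspaceD(1)[OF Linf_subspace])

lemma Linf_cmult: "f \<in> Linf \<mu> \<Longrightarrow> (\<lambda>x. c * f x) \<in> Linf \<mu>"
  by (rule function_subspaceD(2)[OF Linf_subspace])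

lemma Linf_diff: "f \<in> Linf \<mu> \<Longrightarrow> g \<in> Linf \<mu> \<Longrightarrow> (\<lambda>x. f x - g x) \<in> Linf \<mu>"
  using function_subspaceD(1)[OF Linf_subspace _ function_subspaceD(3)[OF Linf_subspace], of f \<mu> g]
  by simp

lemma Linf_I: "f \<in> borel_measurable \<mu> \<Longrightarrow> AE x in \<mu>. \<bar>f x\<bar> \<le> C \<Longrightarrow> f \<in> Linf \<mu>"
  unfolding Linf_def by blast

lemma Linf_measurable: "f \<in> Linf \<mu> \<Longrightarrow> f \<in> borel_measurable \<mu>"
  unfolding Linf_def by blast

lemma convex_expectation_mono:
  assumes "convex_expectation \<mu> \<rho>" "X \<in> Linf \<mu>" "Y \<in> Linf \<mu>" "AE x in \<mu>. X x \<le> Y x"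
  shows "\<rho> X \<le> \<rho> Y"
  using assms unfolding convex_expectation_def by blast

lemma convex_expectation_translate:
  assumes "convex_expectation \<mu> \<rho>" "X \<in> Linf \<mu>"
  shows "\<rho> (\<lambda>x. X x + c) = \<rho> X + c"
  using assms unfolding convex_expectation_def by blast

lemma convex_expectation_convex:
  assumes "convex_expectation \<mu> \<rho>" "X \<in> Linf \<mu>" "Y \<in> Linf \<mu>" "0 \<le> t" "t \<le> 1"
  shows "\<rho> (\<lambda>x. t * X x + (1 - t) * Y x) \<le> t * \<rho> X + (1 - t) * \<rho> Y"
  using assms unfolding convex_expectation_def by simp

text \<open>
  The infima of the tails of a bounded sequence increase to its limit and lie below its members, so
  continuity from below gives lower semicontinuity along all bounded a.e. convergent sequences.
\<close>

lemma convex_expectation_Fatou: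
  assumes \<rho>: "convex_expectation \<mu> \<rho>" and cont: "continuous_from_below \<mu> \<rho>"
    and Y: "\<And>n. Y n \<in> Linf \<mu>" and C: "\<And>n. AE x in \<mu>. \<bar>Y n x\<bar> \<le> C"
    and Z: "Z \<in> Linf \<mu>" and lim: "AE x in \<mu>. (\<lambda>n. Y n x) \<longlonglongrightarrow> Z x"
    and m: "\<And>n. \<rho> (Y n) \<le> m"
  shows "\<rho> Z \<le> m"
proof -
  have [measurable]: "Y n \<in> borel_measurable \<mu>" for n using Y Linf_measurable by blast
  have Call: "AE x in \<mu>. \<forall>n. \<bar>Y n x\<bar> \<le> C" using C by (simp add: AE_all_countable)
  define I where "I n x = (INF k\<in>{n..}. Y k x)" for n x
  have [measurable]: "I n \<in> borel_measurable \<mu>" for n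
    unfolding I_def by (intro borel_measurable_cINF_real) auto
  have bdd: "bdd_below ((\<lambda>k. Y k x) ` {n..})" if "\<forall>n. \<bar>Y n x\<bar> \<le> C" for x n
    by (rule bdd_belowI2[of _ "-C"]) (use that in \<open>auto simp: abs_le_iff minus_le_iff\<close>)
  have le: "I n x \<le> Y k x" if "\<forall>n. \<bar>Y n x\<bar> \<le> C" "n \<le> k" for x n k
    unfolding I_def using bdd[OF that(1)] that(2) by (intro cINF_lower) auto
  have ge: "b \<le> I n x" if "\<And>k. n \<le> k \<Longrightarrow> b \<le> Y k x" for b n x
    unfolding I_def using that by (intro cINF_greatest) auto
  have I_Linf: "I n \<in> Linf \<mu>" for n
  proof (rule Linf_I)
    show "AE x in \<mu>. \<bar>I n x\<bar> \<le> C"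
      using Call
    proof eventually_elim
      case (elim x)
      have "- C \<le> I n x" by (rule ge) (use elim in \<open>auto simp: abs_le_iff minus_le_iff\<close>)
      moreover have "I n x \<le> C" using le[OF elim order_refl, of n] elim by (meson abs_le_D1 order_trans)
      ultimately show ?case by simp
    qed
  qed simp
  have "(\<lambda>n. \<rho> (I n)) \<longlonglongrightarrow> \<rho> Z"
  proof (rule cont[unfolded continuous_from_below_def, rule_format], intro conjI allI)
    show "AE x in \<mu>. incseq (\<lambda>n. I n x)"
      using Call
    proof eventually_elim
      case (elim x)
      show ?case
      proof (rule incseq_SucI)
        show "I n x \<le> I (Suc n) x" for n by (rule ge) (use le[OF elim] in auto)
      qed
    qed
    show "AE x in \<mu>. (\<lambda>n. I n x) \<longlonglongrightarrow> Z x"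
      using Call lim
    proof eventually_elim
      case (elim x)
      show ?case
      proof (rule LIMSEQ_I)
        fix e :: real assume "0 < e"
        then obtain N where N: "\<And>k. N \<le> k \<Longrightarrow> \<bar>Y k x - Z x\<bar> < e/2"
          using LIMSEQ_D[OF elim(2), of "e/2"] by auto
        have "\<bar>I n x - Z x\<bar> < e" if "N \<le> n" for n
        proof -
          have "Z x - e/2 \<le> I n x"
          proof (rule ge)
            fix k assume "n \<le> k" then show "Z x - e/2 \<le> Y k x" using N[of k] that by linarith
          qed
          then show ?thesis using le[OF elim(1) order_refl, of n] N[OF that] \<open>0 < e\<close> by linarith
        qed
        then show "\<exists>N. \<forall>n\<ge>N. norm (I n x - Z x) < e" by auto
      qed
    qed
  qed (use I_Linf Z in auto)
  moreover have "\<rho> (I n) \<le> m" for n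
  proof -
    have "AE x in \<mu>. I n x \<le> Y n x" using Call by eventually_elim (use le in blast)
    then show ?thesis using convex_expectation_mono[OF \<rho> I_Linf Y] m order_trans by blast
  qed
  ultimately show ?thesis by (intro LIMSEQ_le_const2) auto
qed

section \<open>Compact convex sets and small perturbations\<close>

text \<open>
  Bounded convex sets that are closed under a.e. limits are exactly the bounded weak* closed convex
  ones. Their compactness is expressed below by convergent forward convex combinations.
\<close>

definition AE_compact_convex :: "'a measure \<Rightarrow> ('a \<Rightarrow> real) set \<Rightarrow> bool" where
  "AE_compact_convex \<mu> S \<longleftrightarrow> S \<subseteq> Linf \<mu> \<and> function_convex S \<and>
     closed_under_AE_convergence \<mu> S \<and> (\<exists>C. \<forall>X\<in>S. AE x in \<mu>. \<bar>X x\<bar> \<le> C)"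

lemma closed_under_AE_convergenceD:
  assumes "closed_under_AE_convergence \<mu> S" and "\<And>n. f n \<in> S" and "g \<in> borel_measurable \<mu>"
    and "AE x in \<mu>. (\<lambda>n. f n x) \<longlonglongrightarrow> g x"
  obtains h where "h \<in> S" "AE x in \<mu>. h x = g x"
  using assms(1)[unfolded closed_under_AE_convergence_def, rule_format, of f g] assms(2-) by blast

lemma AE_compact_convex_averages:
  assumes "prob_space \<mu>" and S: "AE_compact_convex \<mu> S" and X: "\<And>n. X n \<in> S"
  obtains A Z where "\<And>n. A n \<in> tail_averages n" "Z \<in> S"
    "AE x in \<mu>. (\<lambda>n. A n (\<lambda>j. X j x)) \<longlonglongrightarrow> Z x"
proof -
  interpret prob_space \<mu> by fact
  obtain C where C: "\<And>n. AE x in \<mu>. \<bar>X n x\<bar> \<le> C" using S X unfolding AE_compact_convex_def by blast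
  have Call: "AE x in \<mu>. \<forall>n. \<bar>X n x\<bar> \<le> C" using C by (simp add: AE_all_countable)
  have X_Linf: "X n \<in> Linf \<mu>" for n using S X unfolding AE_compact_convex_def by blast
  then have Xm[measurable]: "X n \<in> borel_measurable \<mu>" for n using Linf_measurable by blast
  have "0 \<le> C"
  proof -
    have "AE x in \<mu>. 0 \<le> C" using C[of 0] by eventually_elim linarith
    then show ?thesis by simp
  qed
  \<comment> \<open>Truncation and a shift make the sequence nonnegative everywhere.\<close>
  define f where "f n x = max (- C) (min C (X n x)) + C" for n x
  have [measurable]: "f n \<in> borel_measurable \<mu>" for n unfolding f_def by simp
  have f_bnd: "0 \<le> f n x" "f n x \<le> 2 * C" for n x using \<open>0 \<le> C\<close> unfolding f_def by auto
  have f_int: "integrable \<mu> (f n)" for n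
    by (rule integrable_const_bound[of _ "2*C"]) (use f_bnd in auto)
  have "(\<integral>x. f n x \<partial>\<mu>) \<le> 2 * C" for n
    using integral_mono[OF f_int, of "\<lambda>_. 2*C" n] f_bnd by (simp add: prob_space)
  then obtain A where A: "\<And>n. A n \<in> tail_averages n"
    and conv: "AE x in \<mu>. convergent (\<lambda>n. A n (\<lambda>j. f j x))"
    using tail_averages_AE_convergent[where f = f, OF prob_space_axioms f_int f_bnd(1)] by blast
  define Y where "Y n x = A n (\<lambda>j. X j x)" for n x
  have Y: "Y n \<in> S" for n
    using tail_average_in_convex[where S = S and X = X, OF A] S X unfolding Y_def AE_compact_convex_def by blast
  have [measurable]: "Y n \<in> borel_measurable \<mu>" for n
    unfolding Y_def by (rule tail_average_measurable[OF A Xm])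
  have Ylim: "AE x in \<mu>. (\<lambda>n. Y n x) \<longlonglongrightarrow> lim (\<lambda>n. Y n x)"
    using conv Call
  proof eventually_elim
    case (elim x)
    have "f j x = 1 * X j x + C * 1" for j using elim(2)[rule_format, of j] unfolding f_def by auto
    then have "A n (\<lambda>j. f j x) = Y n x + C" for n
      using tail_average_linear[OF A, of n 1 "\<lambda>j. X j x" C "\<lambda>_. 1"]
      by (simp add: Y_def tail_average_const[OF A])
    then have "convergent (\<lambda>n. Y n x + C)" using elim(1) by simp
    then have "convergent (\<lambda>n. Y n x)" by (simp add: convergent_add_const_right_iff)
    then show ?case by (simp add: convergent_LIMSEQ_iff)
  qed
  moreover have "(\<lambda>x. lim (\<lambda>n. Y n x)) \<in> borel_measurable \<mu>" by measurable
  ultimately obtain Z where Z: "Z \<in> S" "AE x in \<mu>. Z x = lim (\<lambda>n. Y n x)"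
    using S Y unfolding AE_compact_convex_def closed_under_AE_convergence_def by blast
  have "AE x in \<mu>. (\<lambda>n. A n (\<lambda>j. X j x)) \<longlonglongrightarrow> Z x"
    using Ylim Z(2) by eventually_elim (simp add: Y_def)
  then show ?thesis using that A Z(1) by blast
qed

definition small_perturbations :: "'a measure \<Rightarrow> real \<Rightarrow> real \<Rightarrow> ('a \<Rightarrow> real) set" where
  "small_perturbations \<mu> k \<epsilon> =
     {W \<in> borel_measurable \<mu>. (AE x in \<mu>. 0 \<le> W x \<and> W x \<le> k) \<and> integral\<^sup>L \<mu> W \<le> \<epsilon>}"

lemma small_perturbations_integrable:
  assumes "prob_space \<mu>" "W \<in> small_perturbations \<mu> k \<epsilon>" shows "integrable \<mu> W"
proof -
  interpret prob_space \<mu> by fact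
  have "AE x in \<mu>. 0 \<le> W x \<and> W x \<le> k" using assms(2) unfolding small_perturbations_def by blast
  then have "AE x in \<mu>. norm (W x) \<le> k" by eventually_elim auto
  then show ?thesis
    using assms(2) unfolding small_perturbations_def by (intro integrable_const_bound) auto
qed

lemma small_perturbations_compact:
  assumes "prob_space \<mu>" shows "AE_compact_convex \<mu> (small_perturbations \<mu> k \<epsilon>)"
proof -
  interpret prob_space \<mu> by fact
  let ?U = "small_perturbations \<mu> k \<epsilon>"
  have bnd: "AE x in \<mu>. \<bar>W x\<bar> \<le> k" if "W \<in> ?U" for W
  proof -
    have "AE x in \<mu>. 0 \<le> W x \<and> W x \<le> k" using that unfolding small_perturbations_def by blast
    then show ?thesis by eventually_elim auto
  qed
  have "?U \<subseteq> Linf \<mu>"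
    using bnd Linf_I[of _ \<mu> k] unfolding small_perturbations_def by blast
  moreover have "function_convex ?U"
    unfolding function_convex_def
  proof (intro ballI)
    fix f g and t :: real assume f: "f \<in> ?U" and g: "g \<in> ?U" and t: "t \<in> {0..1}"
    have "AE x in \<mu>. 0 \<le> f x \<and> f x \<le> k" "AE x in \<mu>. 0 \<le> g x \<and> g x \<le> k"
      using f g unfolding small_perturbations_def by blast+
    then have "AE x in \<mu>. 0 \<le> t * f x + (1 - t) * g x \<and> t * f x + (1 - t) * g x \<le> k"
    proof eventually_elim
      case (elim x)
      then show ?case using t convex_bound_le[of "f x" k "g x" t "1 - t"] by auto
    qed
    moreover have "(\<integral>x. t * f x + (1 - t) * g x \<partial>\<mu>) = t * (\<integral>x. f x \<partial>\<mu>) + (1 - t) * (\<integral>x. g x \<partial>\<mu>)"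
      using small_perturbations_integrable[OF assms] f g by simp
    moreover have "\<dots> \<le> \<epsilon>"
      using f g t unfolding small_perturbations_def by (intro convex_bound_le) auto
    ultimately show "(\<lambda>x. t * f x + (1 - t) * g x) \<in> ?U"
      using f g unfolding small_perturbations_def by auto
  qed
  moreover have "closed_under_AE_convergence \<mu> ?U"
    unfolding closed_under_AE_convergence_def
  proof (intro allI impI, elim conjE)
    fix f g assume f: "\<forall>n. f n \<in> ?U" and g: "g \<in> borel_measurable \<mu>"
      and lim: "AE x in \<mu>. (\<lambda>n. f n x) \<longlonglongrightarrow> g x"
    have fb: "AE x in \<mu>. \<forall>n. 0 \<le> f n x \<and> f n x \<le> k"
      using f unfolding AE_all_countable small_perturbations_def by blast
    have "AE x in \<mu>. 0 \<le> g x \<and> g x \<le> k"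
      using fb lim
    proof eventually_elim
      case (elim x)
      then show ?case using LIMSEQ_le_const[OF elim(2), of 0] LIMSEQ_le_const2[OF elim(2), of k] by auto
    qed
    moreover have "(\<lambda>n. \<integral>x. f n x \<partial>\<mu>) \<longlonglongrightarrow> (\<integral>x. g x \<partial>\<mu>)"
    proof (rule integral_dominated_convergence[where w = "\<lambda>_. k"])
      show "AE x in \<mu>. norm (f n x) \<le> k" for n using fb by eventually_elim auto
    qed (use f g lim in \<open>auto simp: small_perturbations_def\<close>)
    then have "(\<integral>x. g x \<partial>\<mu>) \<le> \<epsilon>"
      by (rule LIMSEQ_le_const2) (use f in \<open>auto simp: small_perturbations_def\<close>)
    ultimately have "g \<in> ?U" using g unfolding small_perturbations_def by blast
    then show "\<exists>h\<in>?U. AE x in \<mu>. h x = g x" by auto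
  qed
  ultimately show ?thesis unfolding AE_compact_convex_def using bnd by blast
qed

definition lowered_by :: "('a \<Rightarrow> real) set \<Rightarrow> ('a \<Rightarrow> real) set \<Rightarrow> ('a \<Rightarrow> real) set" where
  "lowered_by S U = {\<lambda>x. X x - W x | X W. X \<in> S \<and> W \<in> U}"

lemma lowered_by_I: "X \<in> S \<Longrightarrow> W \<in> U \<Longrightarrow> (\<lambda>x. X x - W x) \<in> lowered_by S U"
  unfolding lowered_by_def by blast

text \<open>
  The difference of two such sets is again closed: after averaging, the first
  components converge, and then so do the second ones.
\<close>

lemma lowered_by_compact:
  assumes "prob_space \<mu>" and S: "AE_compact_convex \<mu> S" and U: "AE_compact_convex \<mu> U"
  shows "AE_compact_convex \<mu> (lowered_by S U)"
proof -
  have "lowered_by S U \<subseteq> Linf \<mu>"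
    using S U Linf_diff unfolding lowered_by_def AE_compact_convex_def by blast
  moreover have "function_convex (lowered_by S U)"
    unfolding function_convex_def
  proof (intro ballI)
    fix f g and t :: real
    assume "f \<in> lowered_by S U" "g \<in> lowered_by S U" and t: "t \<in> {0..1}"
    then obtain X W X' W' where *: "X \<in> S" "W \<in> U" "X' \<in> S" "W' \<in> U"
      and eq: "f = (\<lambda>x. X x - W x)" "g = (\<lambda>x. X' x - W' x)" unfolding lowered_by_def by blast
    have "(\<lambda>x. t * X x + (1 - t) * X' x) \<in> S" "(\<lambda>x. t * W x + (1 - t) * W' x) \<in> U"
      using * t S U unfolding AE_compact_convex_def function_convex_def by blast+
    moreover have "(\<lambda>x. t * f x + (1 - t) * g x)
      = (\<lambda>x. (t * X x + (1 - t) * X' x) - (t * W x + (1 - t) * W' x))"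
      unfolding eq by (auto simp: algebra_simps)
    ultimately show "(\<lambda>x. t * f x + (1 - t) * g x) \<in> lowered_by S U"
      by (simp only: lowered_by_I)
  qed
  moreover have "closed_under_AE_convergence \<mu> (lowered_by S U)"
    unfolding closed_under_AE_convergence_def
  proof (intro allI impI, elim conjE)
    fix f g assume f: "\<forall>n. f n \<in> lowered_by S U" and g: "g \<in> borel_measurable \<mu>"
      and lim: "AE x in \<mu>. (\<lambda>n. f n x) \<longlonglongrightarrow> g x"
    have "\<exists>X W. X \<in> S \<and> W \<in> U \<and> f n = (\<lambda>x. X x - W x)" for n
      using f unfolding lowered_by_def by blast
    then obtain X W where X: "\<And>n. X n \<in> S" and W: "\<And>n. W n \<in> U"
      and fn: "\<And>n. f n = (\<lambda>x. X n x - W n x)" by metis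
    obtain A Z where A: "\<And>n. A n \<in> tail_averages n" and Z: "Z \<in> S"
      and AZ: "AE x in \<mu>. (\<lambda>n. A n (\<lambda>j. X j x)) \<longlonglongrightarrow> Z x"
      using AE_compact_convex_averages[where X = X, OF assms(1) S X] by blast
    \<comment> \<open>The same averages of the differences still converge to g, so those of the
      perturbations converge as well.\<close>
    have "AE x in \<mu>. (\<lambda>n. A n (\<lambda>j. W j x)) \<longlonglongrightarrow> Z x - g x"
      using AZ lim
    proof eventually_elim
      case (elim x)
      have "A n (\<lambda>j. W j x) = A n (\<lambda>j. X j x) - A n (\<lambda>j. f j x)" for n
        unfolding fn tail_average_diff[OF A] by simp
      then show ?case using tendsto_diff[OF elim(1) tail_averages_tendsto[OF A elim(2)]] by simp
    qed
    moreover have "(\<lambda>x. A n (\<lambda>j. W j x)) \<in> U" for n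
      using tail_average_in_convex[where S = U and X = W, OF A] U W unfolding AE_compact_convex_def by blast
    moreover have "(\<lambda>x. Z x - g x) \<in> borel_measurable \<mu>"
      using Z S g Linf_measurable unfolding AE_compact_convex_def by (intro borel_measurable_diff) auto
    moreover have "closed_under_AE_convergence \<mu> U" using U unfolding AE_compact_convex_def by blast
    ultimately obtain V where V: "V \<in> U" "AE x in \<mu>. V x = Z x - g x"
      using closed_under_AE_convergenceD[where f = "\<lambda>n x. A n (\<lambda>j. W j x)"
          and g = "\<lambda>x. Z x - g x" and S = U] by blast
    show "\<exists>h\<in>lowered_by S U. AE x in \<mu>. h x = g x"
    proof (rule bexI)
      show "(\<lambda>x. Z x - V x) \<in> lowered_by S U" using Z V by (simp add: lowered_by_I)
      show "AE x in \<mu>. Z x - V x = g x" using V(2) by eventually_elim simp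
    qed
  qed
  moreover have "\<exists>C. \<forall>X\<in>lowered_by S U. AE x in \<mu>. \<bar>X x\<bar> \<le> C"
  proof -
    obtain C D where C: "\<And>X. X \<in> S \<Longrightarrow> AE x in \<mu>. \<bar>X x\<bar> \<le> C"
      and D: "\<And>X. X \<in> U \<Longrightarrow> AE x in \<mu>. \<bar>X x\<bar> \<le> D"
      using S U unfolding AE_compact_convex_def by blast
    have "AE x in \<mu>. \<bar>X x - W x\<bar> \<le> C + D" if "X \<in> S" "W \<in> U" for X W
      using C[OF that(1)] D[OF that(2)] by eventually_elim linarith
    then show ?thesis unfolding lowered_by_def by (intro exI[of _ "C + D"]) auto
  qed
  ultimately show ?thesis unfolding AE_compact_convex_def by blast
qed

text \<open>
  Lower semicontinuity is made uniform over a compact set. If the claim failed there would be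
  \<open>X\<^sub>n\<close> in the set and perturbations \<open>W\<^sub>n\<close> with vanishing means violating it; averages of the
  \<open>X\<^sub>n\<close> converge a.e. to some \<open>Z\<close> in the set, the same averages of the \<open>W\<^sub>n\<close> tend to 0, and
  by convexity and the Fatou property \<open>\<rho> Z\<close> would be too small.
\<close>

lemma convex_expectation_uniform_perturbation:
  assumes "prob_space \<mu>" and \<rho>: "convex_expectation \<mu> \<rho>" and cont: "continuous_from_below \<mu> \<rho>"
    and S: "AE_compact_convex \<mu> S" and m: "\<And>X. X \<in> S \<Longrightarrow> m \<le> \<rho> X" and \<delta>: "0 < \<delta>"
  obtains \<epsilon> where "0 < \<epsilon>"
    "\<And>Y. Y \<in> lowered_by S (small_perturbations \<mu> k \<epsilon>) \<Longrightarrow> m - \<delta> \<le> \<rho> Y"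
proof (rule ccontr)
  interpret prob_space \<mu> by fact
  let ?U = "\<lambda>n. small_perturbations \<mu> k (1 / real (Suc n))"
  assume "\<not> thesis"
  then have "\<exists>Y\<in>lowered_by S (?U n). \<rho> Y < m - \<delta>" for n
    using that[of "1 / real (Suc n)"] by fastforce
  then have "\<exists>X W. X \<in> S \<and> W \<in> ?U n \<and> \<rho> (\<lambda>x. X x - W x) < m - \<delta>" for n
    unfolding lowered_by_def by blast
  then obtain X W where X: "\<And>n. X n \<in> S" and W: "\<And>n. W n \<in> ?U n"
    and lt: "\<And>n. \<rho> (\<lambda>x. X n x - W n x) < m - \<delta>" by metis
  obtain A Z where A: "\<And>n. A n \<in> tail_averages n" and Z: "Z \<in> S"
    and AZ: "AE x in \<mu>. (\<lambda>n. A n (\<lambda>j. X j x)) \<longlonglongrightarrow> Z x"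
    using AE_compact_convex_averages[where X = X, OF assms(1) S X] by blast
  define V where "V n x = A n (\<lambda>j. W j x)" for n x
  have V: "V n \<in> ?U n" for n
  proof -
    have "W j \<in> ?U n" if "n \<le> j" for j
    proof -
      have "1 / real (Suc j) \<le> 1 / real (Suc n)" using that by (simp add: frac_le)
      then show ?thesis using W[of j] unfolding small_perturbations_def by auto
    qed
    then show ?thesis
      using tail_average_in_convex[where S = "?U n" and X = W, OF A] small_perturbations_compact[OF assms(1)]
      unfolding V_def AE_compact_convex_def by blast
  qed
  have V_int: "integrable \<mu> (V n)" for n by (rule small_perturbations_integrable[OF assms(1) V])
  have V0: "AE x in \<mu>. 0 \<le> V n x \<and> V n x \<le> k" for n
    using V[of n] unfolding small_perturbations_def by blast
  have "(\<lambda>n. \<integral>x. norm (V n x) \<partial>\<mu>) \<longlonglongrightarrow> 0"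
  proof (rule tendsto_sandwich[OF _ _ tendsto_const LIMSEQ_inverse_real_of_nat])
    have "(\<integral>x. norm (V n x) \<partial>\<mu>) = (\<integral>x. V n x \<partial>\<mu>)" for n
    proof (rule integral_cong_AE)
      show "AE x in \<mu>. norm (V n x) = V n x" using V0[of n] by eventually_elim auto
    qed (use V_int in auto)
    then have "(\<integral>x. norm (V n x) \<partial>\<mu>) \<le> inverse (real (Suc n))" for n
      using V[of n] unfolding small_perturbations_def by (auto simp: inverse_eq_divide)
    then show "\<forall>\<^sub>F n in sequentially. (\<integral>x. norm (V n x) \<partial>\<mu>) \<le> inverse (real (Suc n))" by simp
  qed auto
  then obtain r where r: "strict_mono r" and rV: "AE x in \<mu>. (\<lambda>n. V (r n) x) \<longlonglongrightarrow> 0"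
    using tendsto_L1_AE_subseq[where u = V, OF V_int] by blast
  define Y where "Y n x = A (r n) (\<lambda>j. X j x) - V (r n) x" for n x
  have Y_eq: "Y n = (\<lambda>x. A (r n) (\<lambda>j. X j x - W j x))" for n
    unfolding Y_def V_def tail_average_diff[OF A] ..
  have XW: "(\<lambda>x. X n x - W n x) \<in> Linf \<mu>" for n
    using X W S small_perturbations_compact[OF assms(1)] unfolding AE_compact_convex_def
    by (intro Linf_diff) blast+
  let ?T = "{Z \<in> Linf \<mu>. \<rho> Z \<le> m - \<delta>}"
  have "function_convex ?T"
    unfolding function_convex_def
  proof (intro ballI)
    fix f g and t :: real assume *: "f \<in> ?T" "g \<in> ?T" "t \<in> {0..1}"
    then have "\<rho> (\<lambda>x. t * f x + (1 - t) * g x) \<le> t * \<rho> f + (1 - t) * \<rho> g"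
      by (intro convex_expectation_convex[OF \<rho>]) auto
    also have "\<dots> \<le> m - \<delta>" using * by (intro convex_bound_le) auto
    finally show "(\<lambda>x. t * f x + (1 - t) * g x) \<in> ?T" using * by (auto intro!: Linf_add Linf_cmult)
  qed
  then have YT: "Y n \<in> ?T" for n
    unfolding Y_eq by (intro tail_average_in_convex[OF A]) (use XW lt in \<open>auto intro: less_imp_le\<close>)
  obtain C where C: "\<And>f. f \<in> S \<Longrightarrow> AE x in \<mu>. \<bar>f x\<bar> \<le> C" using S unfolding AE_compact_convex_def by blast
  have AXS: "(\<lambda>x. A n (\<lambda>j. X j x)) \<in> S" for n
    using tail_average_in_convex[where S = S and X = X, OF A] S X unfolding AE_compact_convex_def by blast
  have "\<rho> Z \<le> m - \<delta>"
  proof (rule convex_expectation_Fatou[OF \<rho> cont])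
    show "Y n \<in> Linf \<mu>" "\<rho> (Y n) \<le> m - \<delta>" for n using YT by auto
    show "AE x in \<mu>. \<bar>Y n x\<bar> \<le> C + k" for n
      using C[OF AXS[of "r n"]] V0[of "r n"] by eventually_elim (auto simp: Y_def)
    show "Z \<in> Linf \<mu>" using Z S unfolding AE_compact_convex_def by blast
    show "AE x in \<mu>. (\<lambda>n. Y n x) \<longlonglongrightarrow> Z x"
      using AZ rV
    proof eventually_elim
      case (elim x)
      have "(\<lambda>n. A (r n) (\<lambda>j. X j x)) \<longlonglongrightarrow> Z x"
        using LIMSEQ_subseq_LIMSEQ[OF elim(1) r] by (simp add: o_def)
      from tendsto_diff[OF this elim(2)] show ?case unfolding Y_def by simp
    qed
  qed
  then show False using m[OF Z] \<delta> by simp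
qed

text \<open>
  This does the work of the Krein-Smulian theorem. Subtracting perturbations of size \<open>k\<close> for every
  \<open>k\<close> in turn, each with so small a mean that only \<open>\<delta> / 2\<^sup>k\<^sup>+\<^sup>1\<close> is lost, yields a convex set on
  which the lower bound for \<open>\<rho>\<close> almost persists. A positive functional bounded below on such a set
  must be small on events of small probability.
\<close>

lemma convex_expectation_thickening:
  assumes "prob_space \<mu>" and \<rho>: "convex_expectation \<mu> \<rho>" and cont: "continuous_from_below \<mu> \<rho>"
    and C: "AE_compact_convex \<mu> C" and m: "\<And>X. X \<in> C \<Longrightarrow> m \<le> \<rho> X" and \<delta>: "0 < \<delta>"
  obtains S where "S \<subseteq> Linf \<mu>" "function_convex S" "C \<subseteq> S" "\<And>X. X \<in> S \<Longrightarrow> m - \<delta> \<le> \<rho> X"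
    "\<And>k::nat. \<exists>\<epsilon>>0. \<forall>X\<in>C. \<forall>W\<in>small_perturbations \<mu> k \<epsilon>. (\<lambda>x. X x - W x) \<in> S"
proof -
  let ?P = "\<lambda>n S. AE_compact_convex \<mu> S \<and> (\<forall>X\<in>S. m - \<delta> * (1 - (1/2)^n) \<le> \<rho> X) \<and>
    (n = 0 \<longrightarrow> S = C)"
  let ?Q = "\<lambda>n S S'. \<exists>\<epsilon>>0. S' = lowered_by S (small_perturbations \<mu> (real n) \<epsilon>)"
  have "\<exists>S. \<forall>n. ?P n (S n) \<and> ?Q n (S n) (S (Suc n))"
  proof (rule dependent_nat_choice)
    show "\<exists>S. ?P 0 S" using C m by auto
  next
    fix S n assume S: "?P n S"
    have "0 < \<delta> * (1/2) ^ Suc n" using \<delta> by simp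
    then obtain \<epsilon> where \<epsilon>: "0 < \<epsilon>" "\<And>Y. Y \<in> lowered_by S (small_perturbations \<mu> (real n) \<epsilon>)
        \<Longrightarrow> m - \<delta> * (1 - (1/2)^n) - \<delta> * (1/2) ^ Suc n \<le> \<rho> Y"
      using convex_expectation_uniform_perturbation[OF assms(1) \<rho> cont, of S] S by blast
    have "?P (Suc n) (lowered_by S (small_perturbations \<mu> (real n) \<epsilon>))"
      using \<epsilon>(2) lowered_by_compact[OF assms(1) _ small_perturbations_compact[OF assms(1)]] S
      by (auto simp: algebra_simps)
    then show "\<exists>S'. ?P (Suc n) S' \<and> ?Q n S S'" using \<epsilon>(1) by blast
  qed
  then obtain S where "\<forall>n. ?P n (S n) \<and> ?Q n (S n) (S (Suc n))" by blast
  then have S: "\<And>n. AE_compact_convex \<mu> (S n)" and S\<rho>: "\<And>n X. X \<in> S n \<Longrightarrow> m - \<delta> * (1 - (1/2)^n) \<le> \<rho> X"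
    and Sn: "\<And>n. ?Q n (S n) (S (Suc n))" and S0: "S 0 = C" by blast+
  have S_Suc: "S n \<subseteq> S (Suc n)" for n
  proof
    fix X assume X: "X \<in> S n"
    obtain \<epsilon> where \<epsilon>: "0 < \<epsilon>" "S (Suc n) = lowered_by (S n) (small_perturbations \<mu> (real n) \<epsilon>)"
      using Sn by blast
    have "(\<lambda>_. 0) \<in> small_perturbations \<mu> (real n) \<epsilon>"
      using \<epsilon>(1) unfolding small_perturbations_def by simp
    from lowered_by_I[OF X this] show "X \<in> S (Suc n)" by (simp add: \<epsilon>(2))
  qed
  have S_mono: "S n \<subseteq> S n'" if "n \<le> n'" for n n' by (rule lift_Suc_mono_le[of S, OF S_Suc that])
  show ?thesis
  proof (rule that[of "\<Union>n. S n"])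
    show "(\<Union>n. S n) \<subseteq> Linf \<mu>" using S unfolding AE_compact_convex_def by blast
    show "C \<subseteq> (\<Union>n. S n)" using S0 by blast
    show "function_convex (\<Union>n. S n)"
      unfolding function_convex_def
    proof (intro ballI)
      fix f g and t :: real assume "f \<in> (\<Union>n. S n)" "g \<in> (\<Union>n. S n)" and t: "t \<in> {0..1}"
      then obtain i j where "f \<in> S i" "g \<in> S j" by blast
      then have "f \<in> S (max i j)" "g \<in> S (max i j)"
        using S_mono[of i "max i j"] S_mono[of j "max i j"] by auto
      then have "(\<lambda>x. t * f x + (1 - t) * g x) \<in> S (max i j)"
        using S[of "max i j"] t unfolding AE_compact_convex_def function_convex_def by blast
      then show "(\<lambda>x. t * f x + (1 - t) * g x) \<in> (\<Union>n. S n)" by blast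
    qed
    show "m - \<delta> \<le> \<rho> X" if "X \<in> (\<Union>n. S n)" for X
    proof -
      obtain n where "X \<in> S n" using \<open>X \<in> (\<Union>n. S n)\<close> by blast
      moreover have "m - \<delta> \<le> m - \<delta> * (1 - (1/2)^n)" using \<delta> by (simp add: algebra_simps)
      ultimately show ?thesis using S\<rho> order_trans by blast
    qed
    fix k :: nat
    obtain \<epsilon> where \<epsilon>: "0 < \<epsilon>" "S (Suc k) = lowered_by (S k) (small_perturbations \<mu> (real k) \<epsilon>)"
      using Sn by blast
    have "(\<lambda>x. X x - W x) \<in> (\<Union>n. S n)" if "X \<in> C" "W \<in> small_perturbations \<mu> (real k) \<epsilon>" for X W
    proof -
      have "X \<in> S k" using S_mono[of 0 k] S0 \<open>X \<in> C\<close> by blast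
      then have "(\<lambda>x. X x - W x) \<in> S (Suc k)" unfolding \<epsilon>(2) using that(2) by (rule lowered_by_I)
      then show ?thesis by blast
    qed
    then show "\<exists>\<epsilon>>0. \<forall>X\<in>C. \<forall>W\<in>small_perturbations \<mu> (real k) \<epsilon>. (\<lambda>x. X x - W x) \<in> (\<Union>n. S n)"
      using \<epsilon>(1) by blast
  qed
qed

section \<open>From finitely additive functionals to measures\<close>

text \<open>
  The conclusion says that the affine function \<open>\<beta> + l X - inf l(S)\<close> minorises \<open>\<rho>\<close>, while on
  \<open>S\<close> it is at least \<open>\<beta>\<close>. It is obtained from the Hahn-Banach theorem for
  \<open>p Y = inf {(\<rho> (V + t Y) - \<beta>) / t | V \<in> S, t > 0}\<close>, the least rate at which \<open>\<rho>\<close> rises above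
  \<open>\<beta>\<close> when one leaves \<open>S\<close> in direction \<open>Y\<close>; monotonicity and translation invariance bound it
  below by \<open>- \<parallel>Y\<parallel>\<close>.
\<close>

lemma convex_expectation_sandwich:
  assumes \<rho>: "convex_expectation \<mu> \<rho>" and S: "S \<subseteq> Linf \<mu>" "function_convex S" "S \<noteq> {}"
    and \<beta>: "\<And>V. V \<in> S \<Longrightarrow> \<beta> \<le> \<rho> V"
  obtains l where "\<And>f g. f \<in> Linf \<mu> \<Longrightarrow> g \<in> Linf \<mu> \<Longrightarrow> l (\<lambda>x. f x + g x) = l f + l g"
    "\<And>f c. f \<in> Linf \<mu> \<Longrightarrow> l (\<lambda>x. c * f x) = c * l f"
    "\<And>X V. X \<in> Linf \<mu> \<Longrightarrow> V \<in> S \<Longrightarrow> l X - l V \<le> \<rho> X - \<beta>"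
proof -
  have S_Linf: "V \<in> Linf \<mu>" if "V \<in> S" for V using S that by blast
  define r where "r V t Y = (\<rho> (\<lambda>x. V x + t * Y x) - \<beta>) / t" for V Y :: "'a \<Rightarrow> real" and t
  define p where "p Y = (INF z\<in>S \<times> {0<..}. r (fst z) (snd z) Y)" for Y
  have bdd: "bdd_below ((\<lambda>z. r (fst z) (snd z) Y) ` (S \<times> {0<..}))" if Y: "Y \<in> Linf \<mu>" for Y
  proof -
    obtain K where K: "AE x in \<mu>. \<bar>Y x\<bar> \<le> K" using Linf_bounded[OF Y] .
    have "- K \<le> r V t Y" if V: "V \<in> S" and t: "0 < t" for V t
    proof -
      have "\<beta> + - (t * K) \<le> \<rho> V + - (t * K)" using \<beta>[OF V] by simp
      also have "\<dots> = \<rho> (\<lambda>x. V x + - (t * K))"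
        by (rule convex_expectation_translate[OF \<rho> S_Linf[OF V], symmetric])
      also have "\<dots> \<le> \<rho> (\<lambda>x. V x + t * Y x)"
      proof (rule convex_expectation_mono[OF \<rho>])
        show "AE x in \<mu>. V x + - (t * K) \<le> V x + t * Y x"
          using K
        proof eventually_elim
          case (elim x)
          then have "t * (- K) \<le> t * Y x" using t by (intro mult_left_mono) auto
          then show ?case by simp
        qed
        show "(\<lambda>x. V x + - (t * K)) \<in> Linf \<mu>" by (rule Linf_add[OF S_Linf[OF V] Linf_const])
        show "(\<lambda>x. V x + t * Y x) \<in> Linf \<mu>" by (rule Linf_add[OF S_Linf[OF V] Linf_cmult[OF Y]])
      qed
      finally show ?thesis unfolding r_def using t by (simp add: field_simps)
    qed
    then show ?thesis by (intro bdd_belowI2[of _ "- K"]) auto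
  qed
  have p_le: "p Y \<le> r V t Y" if "Y \<in> Linf \<mu>" "V \<in> S" "0 < t" for Y V t
    unfolding p_def using cINF_lower[OF bdd[OF that(1)], of "(V, t)"] that by simp
  have p_ge: "b \<le> p Y" if "\<And>V t. V \<in> S \<Longrightarrow> 0 < t \<Longrightarrow> b \<le> r V t Y" for b Y
    unfolding p_def
  proof (rule cINF_greatest)
    show "S \<times> {0::real<..} \<noteq> {}" using S(3) by (auto intro: exI[of _ 1])
  qed (use that in auto)
  have "sublinear_on (Linf \<mu>) p"
    unfolding sublinear_on_def
  proof (intro conjI ballI allI impI)
    fix Y1 Y2 assume Y1: "Y1 \<in> Linf \<mu>" and Y2: "Y2 \<in> Linf \<mu>"
    have *: "p (\<lambda>x. Y1 x + Y2 x) \<le> r V1 t1 Y1 + r V2 t2 Y2"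
      if V: "V1 \<in> S" "V2 \<in> S" and t: "0 < t1" "0 < t2" for V1 V2 t1 t2
    proof -
      \<comment> \<open>The weights for which both increments get the same coefficient.\<close>
      define w where "w = t2 / (t1 + t2)"
      define t where "t = t1 * t2 / (t1 + t2)"
      have w: "0 \<le> w" "w \<le> 1" "w * t1 = t" "(1 - w) * t2 = t" and tpos: "0 < t"
        using t unfolding w_def t_def by (auto simp: field_simps)
      then have wt: "w / t = 1 / t1" "(1 - w) / t = 1 / t2"
        using t by (auto simp: frac_eq_eq)
      define V where "V = (\<lambda>x. w * V1 x + (1 - w) * V2 x)"
      have "V \<in> S" using S(2) V w unfolding function_convex_def V_def by simp
      then have "p (\<lambda>x. Y1 x + Y2 x) \<le> r V t (\<lambda>x. Y1 x + Y2 x)"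
        by (intro p_le Linf_add Y1 Y2 tpos)
      also have "\<dots> = (\<rho> (\<lambda>x. w * (V1 x + t1 * Y1 x) + (1 - w) * (V2 x + t2 * Y2 x)) - \<beta>) / t"
      proof -
        have "V x + t * (Y1 x + Y2 x) = w * (V1 x + t1 * Y1 x) + (1 - w) * (V2 x + t2 * Y2 x)" for x
        proof -
          have "w * (V1 x + t1 * Y1 x) + (1 - w) * (V2 x + t2 * Y2 x)
            = V x + (w * t1) * Y1 x + ((1 - w) * t2) * Y2 x"
            unfolding V_def by (simp add: algebra_simps)
          then show ?thesis unfolding w by (simp add: algebra_simps)
        qed
        then show ?thesis unfolding r_def by simp
      qed
      also have "\<dots> \<le> (w * \<rho> (\<lambda>x. V1 x + t1 * Y1 x) + (1 - w) * \<rho> (\<lambda>x. V2 x + t2 * Y2 x) - \<beta>) / t"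
        using tpos w
          convex_expectation_convex[OF \<rho> Linf_add[OF S_Linf[OF V(1)] Linf_cmult[OF Y1]]
            Linf_add[OF S_Linf[OF V(2)] Linf_cmult[OF Y2]] w(1,2)]
        by (intro divide_right_mono diff_right_mono) auto
      also have "\<dots> = (w / t) * (\<rho> (\<lambda>x. V1 x + t1 * Y1 x) - \<beta>)
          + ((1 - w) / t) * (\<rho> (\<lambda>x. V2 x + t2 * Y2 x) - \<beta>)"
        using tpos by (simp add: field_simps)
      also have "\<dots> = r V1 t1 Y1 + r V2 t2 Y2" unfolding wt r_def by simp
      finally show ?thesis .
    qed
    have "p (\<lambda>x. Y1 x + Y2 x) - r V2 t2 Y2 \<le> p Y1" if "V2 \<in> S" "0 < t2" for V2 t2
    proof (rule p_ge)
      fix V1 and t1 :: real assume "V1 \<in> S" "0 < t1"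
      from *[OF this(1) that(1) this(2) that(2)]
      show "p (\<lambda>x. Y1 x + Y2 x) - r V2 t2 Y2 \<le> r V1 t1 Y1" by linarith
    qed
    then have "p (\<lambda>x. Y1 x + Y2 x) - p Y1 \<le> r V2 t2 Y2" if "V2 \<in> S" "0 < t2" for V2 t2
      using that by (simp add: algebra_simps)
    then have "p (\<lambda>x. Y1 x + Y2 x) - p Y1 \<le> p Y2" by (rule p_ge)
    then show "p (\<lambda>x. Y1 x + Y2 x) \<le> p Y1 + p Y2" by simp
  next
    fix Y and c :: real assume Y: "Y \<in> Linf \<mu>" and c: "0 \<le> c"
    show "p (\<lambda>x. c * Y x) = c * p Y"
    proof (cases "c = 0")
      case True
      obtain V where V: "V \<in> S" using S(3) by blast
      have "p (\<lambda>_. 0) = 0"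
      proof (rule antisym)
        show "p (\<lambda>_. 0) \<le> 0"
        proof (rule field_le_epsilon)
          fix e :: real assume e: "0 < e"
          define t where "t = (\<rho> V - \<beta> + 1) / e"
          have t: "0 < t" "\<rho> V - \<beta> \<le> e * t" using \<beta>[OF V] e unfolding t_def by auto
          have "p (\<lambda>_. 0) \<le> r V t (\<lambda>_. 0)" by (rule p_le[OF Linf_const V t(1)])
          also have "\<dots> \<le> 0 + e" using t unfolding r_def by (simp add: field_simps)
          finally show "p (\<lambda>_. 0) \<le> 0 + e" .
        qed
        show "0 \<le> p (\<lambda>_. 0)" by (rule p_ge) (use \<beta> in \<open>simp add: r_def\<close>)
      qed
      then show ?thesis using True by simp
    next
      case False
      then have c: "0 < c" using c by simp
      have eq: "r V t (\<lambda>x. c * Y x) = c * r V (t * c) Y" for V t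
        using c unfolding r_def by (simp add: mult.assoc)
      show ?thesis
      proof (rule antisym)
        have "p (\<lambda>x. c * Y x) / c \<le> p Y"
        proof (rule p_ge)
          fix V and t :: real assume "V \<in> S" "0 < t"
          then have "p (\<lambda>x. c * Y x) \<le> c * r V ((t / c) * c) Y"
            unfolding eq[symmetric] using c by (intro p_le Linf_cmult Y) auto
          then show "p (\<lambda>x. c * Y x) / c \<le> r V t Y" using c by (simp add: field_simps)
        qed
        then show "p (\<lambda>x. c * Y x) \<le> c * p Y" using c by (simp add: field_simps)
        show "c * p Y \<le> p (\<lambda>x. c * Y x)"
        proof (rule p_ge)
          fix V and t :: real assume "V \<in> S" "0 < t"
          then show "c * p Y \<le> r V t (\<lambda>x. c * Y x)"
            unfolding eq using c by (intro mult_left_mono p_le Y) auto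
        qed
      qed
    qed
  qed
  then obtain l where add: "\<And>f g. f \<in> Linf \<mu> \<Longrightarrow> g \<in> Linf \<mu> \<Longrightarrow> l (\<lambda>x. f x + g x) = l f + l g"
    and scale: "\<And>f c. f \<in> Linf \<mu> \<Longrightarrow> l (\<lambda>x. c * f x) = c * l f"
    and lp: "\<And>f. f \<in> Linf \<mu> \<Longrightarrow> l f \<le> p f"
    using Hahn_Banach_sublinear[OF Linf_subspace] by blast
  show ?thesis
  proof (rule that[of l, OF add scale])
    fix X V assume X: "X \<in> Linf \<mu>" and V: "V \<in> S"
    have d: "(\<lambda>x. X x - V x) \<in> Linf \<mu>" by (rule Linf_diff[OF X S_Linf[OF V]])
    have "l X = l (\<lambda>x. (X x - V x) + V x)" by simp
    also have "\<dots> = l (\<lambda>x. X x - V x) + l V" by (rule add[OF d S_Linf[OF V]])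
    finally have "l X - l V = l (\<lambda>x. X x - V x)" by simp
    also have "\<dots> \<le> r V 1 (\<lambda>x. X x - V x)"
      using lp[OF d] p_le[OF d V, of 1] by simp
    finally show "l X - l V \<le> \<rho> X - \<beta>" by (simp add: r_def)
  qed
qed

text \<open>
  The Riesz representation needed here: uniform smallness on events of small probability gives
  continuity at the empty set and so countable additivity, and bounded functions are uniform limits
  of functions with finitely many values.
\<close>

lemma expectation_of_monotone_functional:
  assumes "prob_space \<mu>"
    and add: "\<And>f g. f \<in> Linf \<mu> \<Longrightarrow> g \<in> Linf \<mu> \<Longrightarrow> l (\<lambda>x. f x + g x) = l f + l g"
    and scale: "\<And>f c. f \<in> Linf \<mu> \<Longrightarrow> l (\<lambda>x. c * f x) = c * l f"
    and pos: "\<And>f. f \<in> Linf \<mu> \<Longrightarrow> AE x in \<mu>. 0 \<le> f x \<Longrightarrow> 0 \<le> l f"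
    and one: "l (\<lambda>_. 1) = 1"
    and small: "\<And>e. 0 < e \<Longrightarrow> \<exists>d>0. \<forall>B\<in>sets \<mu>. measure \<mu> B < d \<longrightarrow> l (indicator B) < e"
  obtains P where "P \<in> ac_prob_measures \<mu>" "\<And>X. X \<in> Linf \<mu> \<Longrightarrow> integral\<^sup>L P X = l X"
proof -
  interpret prob_space \<mu> by fact
  have ind: "indicator B \<in> Linf \<mu>" if "B \<in> sets \<mu>" for B
    using that by (intro Linf_I[of _ _ 1]) (auto simp: indicator_def)
  have diff: "l (\<lambda>x. f x - g x) = l f - l g" if "f \<in> Linf \<mu>" "g \<in> Linf \<mu>" for f g
    using add[OF that(1) Linf_cmult[OF that(2)], of "-1"] scale[OF that(2), of "-1"] by simp
  have mono: "l f \<le> l g" if "f \<in> Linf \<mu>" "g \<in> Linf \<mu>" "AE x in \<mu>. f x \<le> g x" for f g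
    using pos[OF Linf_diff[OF that(2,1)]] diff[OF that(2,1)] that(3) by simp
  have const: "l (\<lambda>_. c) = c" for c using scale[OF Linf_const, of c 1] one by simp
  have null: "l (indicator B) = 0" if "B \<in> null_sets \<mu>" for B
  proof -
    have B: "B \<in> sets \<mu>" using that by auto
    have "AE x in \<mu>. indicator B x = (0::real)" using AE_not_in[OF that] by eventually_elim simp
    then have "l (indicator B) \<le> l (\<lambda>_. 0)" "l (\<lambda>_. 0) \<le> l (indicator B)"
      by (auto intro!: mono ind[OF B] Linf_const)
    then show ?thesis using const[of 0] by simp
  qed
  define \<nu> where "\<nu> B = ennreal (l (indicator B))" for B
  define P where "P = measure_of (space \<mu>) (sets \<mu>) \<nu>"
  have ind0: "0 \<le> l (indicator B)" if "B \<in> sets \<mu>" for B by (rule pos[OF ind[OF that]]) simp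
  have "positive (sets \<mu>) \<nu>" using null[of "{}"] unfolding positive_def \<nu>_def by simp
  moreover have "additive (sets \<mu>) \<nu>"
    unfolding additive_def
  proof (intro ballI impI)
    fix A B assume A: "A \<in> sets \<mu>" and B: "B \<in> sets \<mu>" and "A \<inter> B = {}"
    then have "(indicator (A \<union> B) :: 'a \<Rightarrow> real) = (\<lambda>x. indicator A x + indicator B x)"
      by (auto simp: indicator_def fun_eq_iff)
    then show "\<nu> (A \<union> B) = \<nu> A + \<nu> B"
      unfolding \<nu>_def using add[OF ind[OF A] ind[OF B]] ind0[OF A] ind0[OF B] by simp
  qed
  moreover have "(\<lambda>i. \<nu> (B i)) \<longlonglongrightarrow> 0"
    if B: "range B \<subseteq> sets \<mu>" "decseq B" "(\<Inter>i. B i) = {}" for B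
  proof -
    have m: "(\<lambda>i. measure \<mu> (B i)) \<longlonglongrightarrow> 0"
      using finite_Lim_measure_decseq[OF B(1,2)] B(3) by simp
    have "(\<lambda>i. l (indicator (B i))) \<longlonglongrightarrow> 0"
    proof (rule LIMSEQ_I)
      fix e :: real assume "0 < e"
      then obtain d where d: "0 < d" "\<And>B. B \<in> sets \<mu> \<Longrightarrow> measure \<mu> B < d \<Longrightarrow> l (indicator B) < e"
        using small by blast
      obtain N where "\<And>i. N \<le> i \<Longrightarrow> measure \<mu> (B i) < d"
        using LIMSEQ_D[OF m d(1)] by auto
      then have "\<forall>i\<ge>N. norm (l (indicator (B i)) - 0) < e"
        using d(2) B(1) ind0 by (auto simp: subset_iff)
      then show "\<exists>N. \<forall>i\<ge>N. norm (l (indicator (B i)) - 0) < e" ..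
    qed
    then show ?thesis unfolding \<nu>_def using tendsto_ennrealI by fastforce
  qed
  ultimately have ca: "countably_additive (sets \<mu>) \<nu>" and pos\<nu>: "positive (sets \<mu>) \<nu>"
    by (auto intro!: sets.empty_continuous_imp_countably_additive simp: \<nu>_def)
  have setsP[simp, measurable_cong]: "sets P = sets \<mu>" and spaceP: "space P = space \<mu>"
    unfolding P_def by (simp_all add: sets.sigma_sets_eq space_measure_of_conv)
  have emP: "emeasure P B = ennreal (l (indicator B))" if "B \<in> sets \<mu>" for B
    using emeasure_measure_of_sigma[OF sets.sigma_algebra_axioms pos\<nu> ca that]
    unfolding P_def \<nu>_def .
  have "emeasure P (space P) = 1"
  proof -
    have "l (indicator (space \<mu>)) = l (\<lambda>_. 1)"
      by (rule antisym; intro mono ind Linf_const) auto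
    then show ?thesis unfolding spaceP using emP[of "space \<mu>"] one by simp
  qed
  then interpret P: prob_space P by (intro prob_spaceI)
  have ac: "absolutely_continuous \<mu> P"
    unfolding absolutely_continuous_def using emP null by (auto simp: null_sets_def)
  have mP: "measure P B = l (indicator B)" if "B \<in> sets \<mu>" for B
    using emP[OF that] ind0[OF that] by (simp add: measure_def)
  have AE_P: "AE x in P. Q x" if "AE x in \<mu>. Q x" for Q
    by (rule absolutely_continuous_AE[OF setsP ac that])
  have Pint: "integrable P X" if X: "X \<in> Linf \<mu>" for X
  proof -
    obtain K where "AE x in \<mu>. \<bar>X x\<bar> \<le> K" using Linf_bounded[OF X] .
    then have "AE x in P. norm (X x) \<le> K" using AE_P by simp
    then show ?thesis
      using Linf_measurable[OF X] by (intro P.integrable_const_bound) auto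
  qed
  have l_sum: "(\<lambda>x. \<Sum>i\<in>I. c i * indicator (B i) x) \<in> Linf \<mu> \<and>
      l (\<lambda>x. \<Sum>i\<in>I. c i * indicator (B i) x) = (\<Sum>i\<in>I. c i * l (indicator (B i)))"
    if "finite I" "\<And>i. i \<in> I \<Longrightarrow> B i \<in> sets \<mu>" for I :: "int set" and c B
    using that
  proof (induction I)
    case empty
    then show ?case using Linf_const[of 0 \<mu>] const[of 0] by simp
  next
    case (insert i I)
    let ?g = "\<lambda>x. c i * indicator (B i) x" and ?h = "\<lambda>x. \<Sum>j\<in>I. c j * indicator (B j) x"
    have ind_i: "indicator (B i) \<in> Linf \<mu>" using insert by (intro ind) auto
    have g: "?g \<in> Linf \<mu>" "l ?g = c i * l (indicator (B i))"
      by (rule Linf_cmult[OF ind_i], rule scale[OF ind_i])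
    have h: "?h \<in> Linf \<mu>" "l ?h = (\<Sum>j\<in>I. c j * l (indicator (B j)))" using insert by blast+
    show ?case
      unfolding sum.insert[OF insert(1,2)] using Linf_add[OF g(1) h(1)] add[OF g(1) h(1)] g(2) h(2)
      by metis
  qed
  have "integral\<^sup>L P X = l X" if X: "X \<in> Linf \<mu>" for X
  proof -
    obtain K where K: "AE x in \<mu>. \<bar>X x\<bar> \<le> K" using Linf_bounded[OF X] .
    have [measurable]: "X \<in> borel_measurable \<mu>" by (rule Linf_measurable[OF X])
    \<comment> \<open>Rounding the values of X to multiples of e gives a uniformly close simple function.\<close>
    have "\<bar>integral\<^sup>L P X - l X\<bar> \<le> e" if e: "0 < e" for e
    proof -
      define I where "I = {\<lfloor>- K / e\<rfloor>..\<lfloor>K / e\<rfloor>}"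
      define B where "B i = {x \<in> space \<mu>. \<lfloor>X x / e\<rfloor> = i}" for i
      have B[measurable]: "B i \<in> sets \<mu>" for i unfolding B_def by measurable
      define Y where "Y x = (\<Sum>i\<in>I. (e * of_int i) * indicator (B i) x)" for x
      have Y: "Y \<in> Linf \<mu>" and lY: "l Y = (\<Sum>i\<in>I. (e * of_int i) * l (indicator (B i)))"
        using l_sum[of I B "\<lambda>i. e * of_int i"] B unfolding Y_def I_def by auto
      have "integral\<^sup>L P Y = (\<Sum>i\<in>I. (e * of_int i) * measure P (B i))"
        unfolding Y_def using P.emeasure_finite[of "B _"]
        by (subst Bochner_Integration.integral_sum) (auto simp: less_top[symmetric])
      also have "\<dots> = l Y" unfolding lY using mP[OF B] by simp
      finally have PY: "integral\<^sup>L P Y = l Y" .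
      have near: "AE x in \<mu>. Y x \<le> X x \<and> X x \<le> Y x + e"
        using K AE_space
      proof eventually_elim
        case (elim x)
        have "- K / e \<le> X x / e" "X x / e \<le> K / e" using elim e by (auto simp: field_simps abs_le_iff)
        from floor_mono[OF this(1)] floor_mono[OF this(2)]
        have i: "\<lfloor>X x / e\<rfloor> \<in> I" unfolding I_def by simp
        have "Y x = (\<Sum>i\<in>I. if i = \<lfloor>X x / e\<rfloor> then e * of_int i else 0)"
          unfolding Y_def B_def using elim by (intro sum.cong) (auto simp: indicator_def)
        also have "\<dots> = e * of_int \<lfloor>X x / e\<rfloor>" using i by (simp add: I_def)
        finally have Yx: "Y x = e * of_int \<lfloor>X x / e\<rfloor>" .
        have "e * of_int \<lfloor>X x / e\<rfloor> \<le> e * (X x / e)" "e * (X x / e) \<le> e * (of_int \<lfloor>X x / e\<rfloor> + 1)"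
          using e by (intro mult_left_mono; linarith)+
        then show ?case unfolding Yx using e by (simp add: algebra_simps)
      qed
      have "l Y \<le> l X" by (rule mono[OF Y X]) (use near in eventually_elim, simp)
      moreover have "l X \<le> l (\<lambda>x. Y x + e)"
        by (rule mono[OF X Linf_add[OF Y Linf_const]]) (use near in eventually_elim, simp)
      moreover have "l (\<lambda>x. Y x + e) = l Y + e" using add[OF Y Linf_const] const by simp
      moreover have "integral\<^sup>L P Y \<le> integral\<^sup>L P X"
        by (rule integral_mono_AE[OF Pint[OF Y] Pint[OF X]])
          (use AE_P[OF near] in eventually_elim, simp)
      moreover have "integral\<^sup>L P X \<le> (\<integral>x. Y x + e \<partial>P)"
        by (rule integral_mono_AE[OF Pint[OF X]])
          (use Pint[OF Y] AE_P[OF near] in auto)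
      moreover have "(\<integral>x. Y x + e \<partial>P) = integral\<^sup>L P Y + e" using Pint[OF Y] by (simp add: P.prob_space)
      ultimately show ?thesis using PY by linarith
    qed
    then have "\<bar>integral\<^sup>L P X - l X\<bar> \<le> 0 + e" if "0 < e" for e using that by simp
    then have "\<bar>integral\<^sup>L P X - l X\<bar> \<le> 0" by (rule field_le_epsilon)
    then show ?thesis by simp
  qed
  moreover have "P \<in> ac_prob_measures \<mu>"
    unfolding ac_prob_measures_def using ac P.prob_space_axioms by simp
  ultimately show ?thesis using that by blast
qed

text \<open>
  The minimax step up to an error \<open>\<delta>\<close>. The inequality says both that the penalty of \<open>P\<close> is
  finite and that the infimum of \<open>E\<^sub>P\<close> over \<open>C\<close>, less the penalty, is at least \<open>m - \<delta>\<close>. The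
  functional comes from the sandwich lemma for the thickened set; testing it with \<open>X0 - k 1\<^sub>B\<close>
  bounds \<open>l(1\<^sub>B)\<close> by a constant over \<open>k\<close> as soon as \<open>B\<close> has small probability, which makes
  it a measure.
\<close>

lemma approximate_saddle_measure:
  assumes "prob_space \<mu>" and \<rho>: "convex_expectation \<mu> \<rho>" and cont: "continuous_from_below \<mu> \<rho>"
    and C: "AE_compact_convex \<mu> C" "C \<noteq> {}" and m: "\<And>X. X \<in> C \<Longrightarrow> m \<le> \<rho> X" and \<delta>: "0 < \<delta>"
  obtains P where "P \<in> ac_prob_measures \<mu>"
    "\<And>X Y. X \<in> C \<Longrightarrow> Y \<in> Linf \<mu> \<Longrightarrow> integral\<^sup>L P Y - \<rho> Y \<le> integral\<^sup>L P X - (m - \<delta>)"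
proof -
  interpret prob_space \<mu> by fact
  obtain S where S: "S \<subseteq> Linf \<mu>" "function_convex S" and CS: "C \<subseteq> S"
    and mS: "\<And>X. X \<in> S \<Longrightarrow> m - \<delta> \<le> \<rho> X"
    and pert: "\<And>k::nat. \<exists>\<epsilon>>0. \<forall>X\<in>C. \<forall>W\<in>small_perturbations \<mu> k \<epsilon>. (\<lambda>x. X x - W x) \<in> S"
    using convex_expectation_thickening[OF assms(1) \<rho> cont C(1) m \<delta>] by blast
  obtain X0 where X0: "X0 \<in> C" using C(2) by blast
  have "S \<noteq> {}" using X0 CS by blast
  then obtain l where add: "\<And>f g. f \<in> Linf \<mu> \<Longrightarrow> g \<in> Linf \<mu> \<Longrightarrow> l (\<lambda>x. f x + g x) = l f + l g"
    and scale: "\<And>f c. f \<in> Linf \<mu> \<Longrightarrow> l (\<lambda>x. c * f x) = c * l f"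
    and sub: "\<And>X V. X \<in> Linf \<mu> \<Longrightarrow> V \<in> S \<Longrightarrow> l X - l V \<le> \<rho> X - (m - \<delta>)"
    using convex_expectation_sandwich[OF \<rho> S _ mS] by blast
  have X0_Linf: "X0 \<in> Linf \<mu>" using X0 CS S by blast
  have X0_S: "X0 \<in> S" using X0 CS by blast
  define D where "D = \<rho> X0 - (m - \<delta>)"
  have D: "0 \<le> D" using mS[OF X0_S] by (simp add: D_def)
  \<comment> \<open>A convex bound along the whole line through X0 pins down signs and normalisation of l.\<close>
  have ray: "l (\<lambda>x. X0 x + t * Y x) = l X0 + t * l Y" if "Y \<in> Linf \<mu>" for t Y
    using add[OF X0_Linf Linf_cmult[OF that]] scale[OF that] by simp
  have pos: "0 \<le> l Y" if Y: "Y \<in> Linf \<mu>" "AE x in \<mu>. 0 \<le> Y x" for Y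
  proof (rule ccontr)
    assume neg: "\<not> 0 \<le> l Y"
    define t where "t = (D + 1) / l Y"
    have t: "t < 0" "t * l Y = D + 1" using neg D by (auto simp: t_def divide_less_0_iff)
    have "t * l Y \<le> \<rho> (\<lambda>x. X0 x + t * Y x) - (m - \<delta>)"
      using sub[OF Linf_add[OF X0_Linf Linf_cmult[OF Y(1)]] X0_S, of t] ray[OF Y(1)] by simp
    also have "\<rho> (\<lambda>x. X0 x + t * Y x) \<le> \<rho> X0"
    proof (rule convex_expectation_mono[OF \<rho> _ X0_Linf])
      show "AE x in \<mu>. X0 x + t * Y x \<le> X0 x"
        using Y(2) by eventually_elim (use t in \<open>simp add: mult_nonpos_nonneg\<close>)
    qed (intro Linf_add X0_Linf Linf_cmult Y)
    finally show False using t(2) unfolding D_def by simp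
  qed
  have one: "l (\<lambda>_. 1) = 1"
  proof (rule ccontr)
    assume ne: "l (\<lambda>_. 1) \<noteq> 1"
    define t where "t = (D + 1) / (l (\<lambda>_. 1) - 1)"
    have "t * l (\<lambda>_. 1) \<le> \<rho> (\<lambda>x. X0 x + t * 1) - (m - \<delta>)"
      using sub[OF Linf_add[OF X0_Linf Linf_cmult[OF Linf_const]] X0_S, of t 1] ray[OF Linf_const, of t 1]
      by simp
    also have "\<rho> (\<lambda>x. X0 x + t * 1) = \<rho> X0 + t"
      using convex_expectation_translate[OF \<rho> X0_Linf] by simp
    finally have "t * (l (\<lambda>_. 1) - 1) \<le> D" unfolding D_def by (simp add: algebra_simps)
    then show False using ne unfolding t_def by simp
  qed
  have small: "\<exists>d>0. \<forall>B\<in>sets \<mu>. measure \<mu> B < d \<longrightarrow> l (indicator B) < e" if e: "0 < e" for e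
  proof -
    \<comment> \<open>E bounds l on all perturbations W for which X0 - W lies in S.\<close>
    define E where "E = l X0 + \<rho> (\<lambda>_. 0) - (m - \<delta>)"
    obtain k :: nat where k: "0 < k" "E < e * k"
    proof -
      obtain k :: nat where "\<bar>E\<bar> / e < k" using reals_Archimedean2 by blast
      moreover from this have "0 < real k" using e by (intro le_less_trans[OF _ \<open>\<bar>E\<bar> / e < k\<close>]) auto
      ultimately show ?thesis using that[of k] e by (auto simp: field_simps)
    qed
    obtain \<epsilon> where \<epsilon>: "0 < \<epsilon>"
      "\<And>X W. X \<in> C \<Longrightarrow> W \<in> small_perturbations \<mu> k \<epsilon> \<Longrightarrow> (\<lambda>x. X x - W x) \<in> S"
      using pert[of k] by blast
    have "l (indicator B) < e" if B: "B \<in> sets \<mu>" and small: "measure \<mu> B < \<epsilon> / k" for B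
    proof -
      let ?W = "\<lambda>x. real k * indicator B x"
      have ind: "indicator B \<in> Linf \<mu>"
        using B by (intro Linf_I[of _ _ 1]) (auto simp: indicator_def)
      have "integral\<^sup>L \<mu> ?W = k * measure \<mu> B" using B by (simp add: emeasure_finite)
      also have "\<dots> \<le> \<epsilon>" using small k(1) by (simp add: field_simps)
      finally have "?W \<in> small_perturbations \<mu> k \<epsilon>"
        using B unfolding small_perturbations_def by (auto simp: indicator_def)
      then have "(\<lambda>x. X0 x - ?W x) \<in> S" by (rule \<epsilon>(2)[OF X0])
      then have "l (\<lambda>_. 0) - l (\<lambda>x. X0 x - ?W x) \<le> \<rho> (\<lambda>_. 0) - (m - \<delta>)"
        by (rule sub[OF Linf_const])
      moreover have "l (\<lambda>x. X0 x - ?W x) = l X0 - k * l (indicator B)"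
        using ray[OF ind, of "- real k"] by simp
      moreover have "l (\<lambda>_. 0) = 0" using scale[OF Linf_const, of 0 0] by simp
      ultimately have "k * l (indicator B) < e * k" using k(2) unfolding E_def by simp
      then show ?thesis using k(1) by (simp add: mult.commute)
    qed
    then show ?thesis using \<epsilon>(1) k(1) by (intro exI[of _ "\<epsilon> / k"]) auto
  qed
  obtain P where P: "P \<in> ac_prob_measures \<mu>" and Pl: "\<And>X. X \<in> Linf \<mu> \<Longrightarrow> integral\<^sup>L P X = l X"
    using expectation_of_monotone_functional[where l = l, OF assms(1) add scale pos one small] by blast
  show ?thesis
  proof (rule that[OF P])
    fix X Y assume X: "X \<in> C" and Y: "Y \<in> Linf \<mu>"
    have "X \<in> S" "X \<in> Linf \<mu>" using X CS S by blast+
    then show "integral\<^sup>L P Y - \<rho> Y \<le> integral\<^sup>L P X - (m - \<delta>)"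
      using sub[OF Y] Pl Y by fastforce
  qed
qed

section \<open>Passing to the limit in the level set of the penalty\<close>

lemma density_of_properties:
  assumes "prob_space \<mu>" and P: "P \<in> ac_prob_measures \<mu>"
  shows "density_of \<mu> P \<in> borel_measurable \<mu>" "0 \<le> density_of \<mu> P x"
    "density \<mu> (\<lambda>x. ennreal (density_of \<mu> P x)) = P"
    "integrable \<mu> (density_of \<mu> P)" "(\<integral>x. density_of \<mu> P x \<partial>\<mu>) = 1"
    "Y \<in> borel_measurable \<mu> \<Longrightarrow> integral\<^sup>L P Y = (\<integral>x. density_of \<mu> P x * Y x \<partial>\<mu>)"
proof -
  interpret prob_space \<mu> by fact
  have ac: "absolutely_continuous \<mu> P" and setsP: "sets P = sets \<mu>" and "prob_space P"
    using P unfolding ac_prob_measures_def by auto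
  interpret P: prob_space P by fact
  show m[measurable]: "density_of \<mu> P \<in> borel_measurable \<mu>" unfolding density_of_def by simp
  show nn: "0 \<le> density_of \<mu> P x" for x unfolding density_of_def by simp
  have "AE x in \<mu>. RN_deriv \<mu> P x \<noteq> \<infinity>"
    by (rule RN_deriv_finite[OF P.sigma_finite_measure_axioms ac setsP])
  then have "density \<mu> (\<lambda>x. ennreal (density_of \<mu> P x)) = density \<mu> (RN_deriv \<mu> P)"
    by (intro density_cong) (auto simp: density_of_def less_top elim!: eventually_mono)
  then show dens: "density \<mu> (\<lambda>x. ennreal (density_of \<mu> P x)) = P"
    using density_RN_deriv[OF ac setsP] by simp
  have "(\<integral>\<^sup>+x. ennreal (density_of \<mu> P x) \<partial>\<mu>)
      = emeasure (density \<mu> (\<lambda>x. ennreal (density_of \<mu> P x))) (space \<mu>)"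
    by (subst emeasure_density) (auto intro!: nn_integral_cong)
  also have "\<dots> = 1" unfolding dens using P.emeasure_space_1 sets_eq_imp_space_eq[OF setsP] by simp
  finally have nn1: "(\<integral>\<^sup>+x. ennreal (density_of \<mu> P x) \<partial>\<mu>) = 1" .
  show "integrable \<mu> (density_of \<mu> P)"
    by (rule integrableI_nonneg) (auto simp: nn nn1)
  show "(\<integral>x. density_of \<mu> P x \<partial>\<mu>) = 1"
    by (subst integral_eq_nn_integral) (auto simp: nn nn1)
  show "integral\<^sup>L P Y = (\<integral>x. density_of \<mu> P x * Y x \<partial>\<mu>)" if "Y \<in> borel_measurable \<mu>"
    using integral_density[OF that m] nn unfolding dens by simp
qed

lemma density_measure_properties:
  assumes "prob_space \<mu>" and g: "integrable \<mu> g" and g0: "\<And>x. 0 \<le> g x" and g1: "(\<integral>x. g x \<partial>\<mu>) = 1"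
  shows "density \<mu> (\<lambda>x. ennreal (g x)) \<in> ac_prob_measures \<mu>"
    "AE x in \<mu>. density_of \<mu> (density \<mu> (\<lambda>x. ennreal (g x))) x = g x"
proof -
  interpret prob_space \<mu> by fact
  have [measurable]: "g \<in> borel_measurable \<mu>" using g by blast
  let ?P = "density \<mu> (\<lambda>x. ennreal (g x))"
  have "(\<integral>\<^sup>+x. ennreal (g x) \<partial>\<mu>) = 1"
    using nn_integral_eq_integral[OF g] g0 g1 by simp
  then have "emeasure ?P (space ?P) = 1"
    by (simp add: emeasure_density cong: nn_integral_cong)
  then show "?P \<in> ac_prob_measures \<mu>"
    unfolding ac_prob_measures_def by (auto intro!: prob_spaceI absolutely_continuousI_density)
  have "AE x in \<mu>. ennreal (g x) = RN_deriv \<mu> ?P x"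
    by (rule RN_deriv_unique) auto
  then show "AE x in \<mu>. density_of \<mu> ?P x = g x"
  proof eventually_elim
    case (elim x)
    show ?case unfolding density_of_def elim[symmetric] using g0 by simp
  qed
qed

lemma Linf_mult_integrable:
  assumes Y: "Y \<in> Linf \<mu>" and g: "integrable \<mu> g"
  shows "integrable \<mu> (\<lambda>x. g x * Y x)"
proof -
  obtain K where K: "AE x in \<mu>. \<bar>Y x\<bar> \<le> K" using Linf_bounded[OF Y] .
  show ?thesis
  proof (rule Bochner_Integration.integrable_bound)
    show "integrable \<mu> (\<lambda>x. K * g x)" using g by simp
    show "AE x in \<mu>. norm (g x * Y x) \<le> norm (K * g x)"
      using K
    proof eventually_elim
      case (elim x)
      have "\<bar>Y x\<bar> * \<bar>g x\<bar> \<le> \<bar>K\<bar> * \<bar>g x\<bar>" using elim by (intro mult_right_mono) auto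
      then show ?case by (simp add: abs_mult mult.commute)
    qed
  qed (use g Y[THEN Linf_measurable] in auto)
qed

text \<open>
  Scheffe's lemma: if the limit of probability densities is a probability density, the convergence
  holds in the mean.
\<close>

lemma AE_convergent_densities_integral:
  fixes g :: "nat \<Rightarrow> 'a \<Rightarrow> real"
  assumes gi: "\<And>n. integrable \<mu> (g n)" and hi: "integrable \<mu> h"
    and g0: "\<And>n x. 0 \<le> g n x" and h0: "\<And>x. 0 \<le> h x"
    and g1: "\<And>n. (\<integral>x. g n x \<partial>\<mu>) = 1" and h1: "(\<integral>x. h x \<partial>\<mu>) = 1"
    and lim: "AE x in \<mu>. (\<lambda>n. g n x) \<longlonglongrightarrow> h x" and Y: "Y \<in> Linf \<mu>"
  shows "(\<lambda>n. \<integral>x. g n x * Y x \<partial>\<mu>) \<longlonglongrightarrow> (\<integral>x. h x * Y x \<partial>\<mu>)"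
proof -
  obtain K where K: "AE x in \<mu>. \<bar>Y x\<bar> \<le> K" using Linf_bounded[OF Y] .
  have "(\<lambda>n. \<integral>\<^sup>+x. norm (g n x - h x) \<partial>\<mu>) \<longlonglongrightarrow> 0"
  proof (rule Scheffe_lemma2[OF _ hi lim])
    have "(\<integral>\<^sup>+x. norm (f x) \<partial>\<mu>) = 1" if "integrable \<mu> f" "\<And>x. 0 \<le> f x" "(\<integral>x. f x \<partial>\<mu>) = 1"
      for f :: "'a \<Rightarrow> real"
      using nn_integral_eq_integral[OF that(1)] that by simp
    then show "(\<integral>\<^sup>+x. norm (g n x) \<partial>\<mu>) \<le> (\<integral>\<^sup>+x. norm (h x) \<partial>\<mu>)" for n
      using gi g0 g1 hi h0 h1 by simp
  qed (use gi in auto)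
  moreover have "(\<integral>\<^sup>+x. norm (g n x - h x) \<partial>\<mu>) = ennreal (\<integral>x. \<bar>g n x - h x\<bar> \<partial>\<mu>)" for n
    using gi hi by (subst nn_integral_eq_integral) auto
  ultimately have L1: "(\<lambda>n. \<integral>x. \<bar>g n x - h x\<bar> \<partial>\<mu>) \<longlonglongrightarrow> 0"
    using ennreal_tendsto_0_iff[of "\<lambda>n. \<integral>x. \<bar>g n x - h x\<bar> \<partial>\<mu>"] by simp
  have bound: "\<bar>(\<integral>x. g n x * Y x \<partial>\<mu>) - (\<integral>x. h x * Y x \<partial>\<mu>)\<bar> \<le> (\<integral>x. \<bar>g n x - h x\<bar> \<partial>\<mu>) * K" for n
  proof -
    have d: "integrable \<mu> (\<lambda>x. g n x - h x)" using gi hi by simp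
    have "(\<integral>x. g n x * Y x \<partial>\<mu>) - (\<integral>x. h x * Y x \<partial>\<mu>) = (\<integral>x. (g n x - h x) * Y x \<partial>\<mu>)"
      using Linf_mult_integrable[OF Y gi] Linf_mult_integrable[OF Y hi] by (simp add: left_diff_distrib)
    also have "\<bar>\<dots>\<bar> \<le> (\<integral>x. \<bar>(g n x - h x) * Y x\<bar> \<partial>\<mu>)" by (rule integral_abs_bound)
    also have "\<dots> \<le> (\<integral>x. \<bar>g n x - h x\<bar> * K \<partial>\<mu>)"
    proof (rule integral_mono_AE)
      show "AE x in \<mu>. \<bar>(g n x - h x) * Y x\<bar> \<le> \<bar>g n x - h x\<bar> * K"
        using K by eventually_elim (auto simp: abs_mult intro: mult_left_mono)
    qed (use d Linf_mult_integrable[OF Y d] in auto)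
    finally show ?thesis by simp
  qed
  have "(\<lambda>n. (\<integral>x. g n x * Y x \<partial>\<mu>) - (\<integral>x. h x * Y x \<partial>\<mu>)) \<longlonglongrightarrow> 0"
  proof (rule Lim_null_comparison)
    show "(\<lambda>n. (\<integral>x. \<bar>g n x - h x\<bar> \<partial>\<mu>) * K) \<longlonglongrightarrow> 0" by (rule tendsto_mult_left_zero[OF L1])
    show "\<forall>\<^sub>F n in sequentially. norm ((\<integral>x. g n x * Y x \<partial>\<mu>) - (\<integral>x. h x * Y x \<partial>\<mu>))
      \<le> (\<integral>x. \<bar>g n x - h x\<bar> \<partial>\<mu>) * K"
      unfolding real_norm_def by (rule always_eventually) (intro allI bound)
  qed
  then show ?thesis by (rule LIM_zero_cancel)
qed

text \<open>
  The error of the minimax step is removed here. The approximate measures have penalties at most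
  \<open>b - m + 1\<close>, hence lie in the closed level set, and so do forward convex combinations of them.
  Such combinations of their densities converge a.e.; closedness identifies the limit as a density
  of total mass 1, so no mass escapes and the inequality passes to the limit.
\<close>

lemma saddle_measure_exists:
  assumes "prob_space \<mu>" and \<rho>: "convex_expectation \<mu> \<rho>" and cont: "continuous_from_below \<mu> \<rho>"
    and C: "AE_compact_convex \<mu> C" and m: "\<And>X. X \<in> C \<Longrightarrow> m \<le> \<rho> X"
    and X0: "X0 \<in> C" "AE x in \<mu>. X0 x \<le> b" and u: "b - m + 1 \<le> u"
    and cl: "closed_under_AE_convergence \<mu> (density_level_set \<mu> \<rho> u)"
  obtains P where "P \<in> finite_penalty_measures \<mu> \<rho>"
    "\<And>X Y. X \<in> C \<Longrightarrow> Y \<in> Linf \<mu> \<Longrightarrow> integral\<^sup>L P Y - \<rho> Y \<le> integral\<^sup>L P X - m"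
proof -
  interpret prob_space \<mu> by fact
  have C_Linf: "X \<in> Linf \<mu>" if "X \<in> C" for X using C that unfolding AE_compact_convex_def by blast
  have "\<exists>P. P \<in> ac_prob_measures \<mu> \<and> (\<forall>X\<in>C. \<forall>Y\<in>Linf \<mu>.
      integral\<^sup>L P Y - \<rho> Y \<le> integral\<^sup>L P X - (m - 1 / real (Suc n)))" for n
    using approximate_saddle_measure[OF assms(1) \<rho> cont C _ m, of "1 / real (Suc n)"] X0(1)
    by (metis empty_iff of_nat_0_less_iff zero_less_Suc zero_less_divide_1_iff)
  then obtain P where P: "\<And>n. P n \<in> ac_prob_measures \<mu>"
    and saddle: "\<And>n X Y. X \<in> C \<Longrightarrow> Y \<in> Linf \<mu> \<Longrightarrow>
      integral\<^sup>L (P n) Y - \<rho> Y \<le> integral\<^sup>L (P n) X - (m - 1 / real (Suc n))"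
    by metis
  define f where "f n = density_of \<mu> (P n)" for n
  note f = density_of_properties[OF assms(1) P, folded f_def]
  obtain A where A: "\<And>n. A n \<in> tail_averages n"
    and conv: "AE x in \<mu>. convergent (\<lambda>n. A n (\<lambda>j. f j x))"
    using tail_averages_AE_convergent[where f = f and K = 1, OF assms(1) f(4) f(2)] f(5) by auto
  define g where "g n x = A n (\<lambda>j. f j x)" for n x
  have g_int: "integrable \<mu> (g n)" and g1: "(\<integral>x. g n x \<partial>\<mu>) = 1" for n
    using tail_average_integral[where f = f, OF A f(4)] f(5)
    unfolding g_def by (auto simp: tail_average_const[OF A])
  have gm[measurable]: "g n \<in> borel_measurable \<mu>" for n using g_int by blast
  have g0: "0 \<le> g n x" for n x
    using tail_average_mono[OF A, of n "\<lambda>_. 0" "\<lambda>j. f j x"] f(2)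
    by (simp add: tail_average_const[OF A] g_def)
  have gY: "(\<integral>x. g n x * Y x \<partial>\<mu>) = A n (\<lambda>j. integral\<^sup>L (P j) Y)" if Y: "Y \<in> Linf \<mu>" for n Y
    using tail_average_integral[where f = "\<lambda>j x. f j x * Y x", OF A Linf_mult_integrable[OF Y f(4)]]
      f(6)[OF Linf_measurable[OF Y]]
    unfolding g_def by (simp add: tail_average_cmult[OF A])
  have g_saddle: "(\<integral>x. g n x * Y x \<partial>\<mu>) - \<rho> Y \<le> (\<integral>x. g n x * X x \<partial>\<mu>) - (m - 1 / real (Suc n))"
    if X: "X \<in> C" and Y: "Y \<in> Linf \<mu>" for n X Y
  proof -
    have "A n (\<lambda>j. integral\<^sup>L (P j) Y - integral\<^sup>L (P j) X) \<le> A n (\<lambda>_. \<rho> Y - (m - 1 / real (Suc n)))"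
    proof (rule tail_average_mono[OF A])
      fix j assume "n \<le> j"
      then have "1 / real (Suc j) \<le> 1 / real (Suc n)" by (simp add: frac_le)
      then show "integral\<^sup>L (P j) Y - integral\<^sup>L (P j) X \<le> \<rho> Y - (m - 1 / real (Suc n))"
        using saddle[OF X Y, of j] by linarith
    qed
    then show ?thesis
      unfolding gY[OF Y] gY[OF C_Linf[OF X]] tail_average_diff[OF A] tail_average_const[OF A] by linarith
  qed
  \<comment> \<open>Testing the averaged inequality with X0 bounds the penalty of the averaged measure.\<close>
  define R where "R n = density \<mu> (\<lambda>x. ennreal (g n x))" for n
  note R = density_measure_properties[OF assms(1) g_int g0 g1, folded R_def]
  have RY: "integral\<^sup>L (R n) Y = (\<integral>x. g n x * Y x \<partial>\<mu>)" if "Y \<in> borel_measurable \<mu>" for n Y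
    unfolding R_def using integral_density[OF that gm] g0 by simp
  have "density_of \<mu> (R n) \<in> density_level_set \<mu> \<rho> u" for n
  proof -
    have "integral\<^sup>L (R n) Y - \<rho> Y \<le> u" if Y: "Y \<in> Linf \<mu>" for Y
    proof -
      have "(\<integral>x. g n x * X0 x \<partial>\<mu>) \<le> (\<integral>x. g n x * b \<partial>\<mu>)"
      proof (rule integral_mono_AE)
        show "AE x in \<mu>. g n x * X0 x \<le> g n x * b"
          using X0(2) by eventually_elim (auto intro: mult_left_mono g0)
      qed (use g_int Linf_mult_integrable[OF C_Linf[OF X0(1)] g_int] in auto)
      also have "\<dots> = b" using g1 by simp
      finally have "(\<integral>x. g n x * X0 x \<partial>\<mu>) \<le> b" .
      moreover have "1 / real (Suc n) \<le> 1" by simp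
      ultimately show ?thesis
        unfolding RY[OF Linf_measurable[OF Y]] using g_saddle[OF X0(1) Y, of n] u by linarith
    qed
    then have "penalty \<mu> \<rho> (R n) \<le> ereal u" unfolding penalty_def by (intro SUP_least) simp
    then show ?thesis
      using R(1) unfolding density_level_set_def finite_penalty_measures_def
      by (auto intro!: exI[of _ "R n"] elim: order.strict_trans1)
  qed
  moreover have lim: "AE x in \<mu>. (\<lambda>n. density_of \<mu> (R n) x) \<longlonglongrightarrow> lim (\<lambda>n. g n x)"
  proof -
    have "AE x in \<mu>. \<forall>n. density_of \<mu> (R n) x = g n x" using R(2) by (simp add: AE_all_countable)
    then show ?thesis using conv
      by eventually_elim (simp add: g_def convergent_LIMSEQ_iff)
  qed
  moreover have "(\<lambda>x. lim (\<lambda>n. g n x)) \<in> borel_measurable \<mu>" by measurable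
  ultimately obtain h where h: "h \<in> density_level_set \<mu> \<rho> u" "AE x in \<mu>. h x = lim (\<lambda>n. g n x)"
    using closed_under_AE_convergenceD[where f = "\<lambda>n. density_of \<mu> (R n)", OF cl] by blast
  then obtain Q where Q: "Q \<in> finite_penalty_measures \<mu> \<rho>" and hQ: "h = density_of \<mu> Q"
    unfolding density_level_set_def by blast
  have Q_ac: "Q \<in> ac_prob_measures \<mu>" using Q unfolding finite_penalty_measures_def by blast
  note q = density_of_properties[OF assms(1) Q_ac]
  have glim: "AE x in \<mu>. (\<lambda>n. g n x) \<longlonglongrightarrow> density_of \<mu> Q x"
    using conv h(2) unfolding hQ by eventually_elim (simp add: g_def convergent_LIMSEQ_iff)
  have intlim: "(\<lambda>n. \<integral>x. g n x * Y x \<partial>\<mu>) \<longlonglongrightarrow> integral\<^sup>L Q Y" if Y: "Y \<in> Linf \<mu>" for Y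
    using AE_convergent_densities_integral[OF g_int q(4) g0 q(2) g1 q(5) glim Y]
    unfolding q(6)[OF Linf_measurable[OF Y]] .
  show ?thesis
  proof (rule that[OF Q])
    fix X Y assume X: "X \<in> C" and Y: "Y \<in> Linf \<mu>"
    have "(\<lambda>n. (\<integral>x. g n x * Y x \<partial>\<mu>) - \<rho> Y) \<longlonglongrightarrow> integral\<^sup>L Q Y - \<rho> Y"
      by (intro tendsto_intros intlim Y)
    moreover have "(\<lambda>n. (\<integral>x. g n x * X x \<partial>\<mu>) - (m - inverse (real (Suc n)))) \<longlonglongrightarrow> integral\<^sup>L Q X - (m - 0)"
      by (intro tendsto_diff tendsto_const intlim C_Linf X LIMSEQ_inverse_real_of_nat)
    ultimately show "integral\<^sup>L Q Y - \<rho> Y \<le> integral\<^sup>L Q X - m"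
      using g_saddle[OF X Y] by (intro LIMSEQ_le) (auto simp: inverse_eq_divide)
  qed
qed

section \<open>The dual testing problem\<close>

lemma dual_tests_compact:
  assumes "prob_space \<mu>" and Q: "Q \<in> ac_prob_measures \<mu>" and K: "K1 \<in> Linf \<mu>" "K2 \<in> Linf \<mu>"
  shows "AE_compact_convex \<mu> (dual_tests \<mu> Q K1 K2 \<gamma>)"
proof -
  interpret prob_space \<mu> by fact
  have ac: "absolutely_continuous \<mu> Q" and setsQ[measurable_cong]: "sets Q = sets \<mu>" and "prob_space Q"
    using Q unfolding ac_prob_measures_def by auto
  interpret Q: prob_space Q by fact
  note AE_Q = absolutely_continuous_AE[OF setsQ ac]
  let ?D = "dual_tests \<mu> Q K1 K2 \<gamma>"
  obtain C1 where C1: "AE x in \<mu>. \<bar>K1 x\<bar> \<le> C1" using Linf_bounded[OF K(1)] .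
  obtain C2 where C2: "AE x in \<mu>. \<bar>K2 x\<bar> \<le> C2" using Linf_bounded[OF K(2)] .
  have D: "X \<in> Linf \<mu>" "AE x in \<mu>. K1 x \<le> X x \<and> X x \<le> K2 x" "(\<integral>x. K2 x - X x \<partial>Q) \<le> \<gamma>"
    if "X \<in> ?D" for X
    using that unfolding dual_tests_def tests_between_def by auto
  have bnd: "AE x in \<mu>. \<bar>X x\<bar> \<le> C1 + C2" if "X \<in> ?D" for X
    using D(2)[OF that] C1 C2 by eventually_elim linarith
  have int: "integrable Q X" if X: "X \<in> Linf \<mu>" for X
  proof -
    obtain C where "AE x in \<mu>. \<bar>X x\<bar> \<le> C" using Linf_bounded[OF X] .
    then show ?thesis
      using AE_Q[of "\<lambda>x. \<bar>X x\<bar> \<le> C"] Linf_measurable[OF X] by (intro Q.integrable_const_bound) auto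
  qed
  have "function_convex ?D"
    unfolding function_convex_def
  proof (intro ballI)
    fix f g and t :: real assume f: "f \<in> ?D" and g: "g \<in> ?D" and t: "t \<in> {0..1}"
    have "AE x in \<mu>. K1 x \<le> t * f x + (1 - t) * g x \<and> t * f x + (1 - t) * g x \<le> K2 x"
      using D(2)[OF f] D(2)[OF g]
    proof eventually_elim
      case (elim x)
      then show ?case
        using t convex_bound_le[of "f x" "K2 x" "g x" t "1 - t"]
          convex_bound_le[of "- f x" "- K1 x" "- g x" t "1 - t"] by auto
    qed
    moreover have "(\<integral>x. K2 x - (t * f x + (1 - t) * g x) \<partial>Q)
      = t * (\<integral>x. K2 x - f x \<partial>Q) + (1 - t) * (\<integral>x. K2 x - g x \<partial>Q)"
      using int[OF K(2)] int[OF D(1)[OF f]] int[OF D(1)[OF g]] by (simp add: algebra_simps)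
    moreover have "\<dots> \<le> \<gamma>" using D(3)[OF f] D(3)[OF g] t by (intro convex_bound_le) auto
    ultimately show "(\<lambda>x. t * f x + (1 - t) * g x) \<in> ?D"
      unfolding dual_tests_def tests_between_def
      using Linf_add[OF Linf_cmult[OF D(1)[OF f]] Linf_cmult[OF D(1)[OF g]]] by simp
  qed
  moreover have "closed_under_AE_convergence \<mu> ?D"
    unfolding closed_under_AE_convergence_def
  proof (intro allI impI, elim conjE)
    fix f g assume f: "\<forall>n. f n \<in> ?D" and g[measurable]: "g \<in> borel_measurable \<mu>"
      and lim: "AE x in \<mu>. (\<lambda>n. f n x) \<longlonglongrightarrow> g x"
    have fb: "AE x in \<mu>. \<forall>n. K1 x \<le> f n x \<and> f n x \<le> K2 x"
      unfolding AE_all_countable using D(2) f by blast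
    have gb: "AE x in \<mu>. K1 x \<le> g x \<and> g x \<le> K2 x"
      using fb lim
    proof eventually_elim
      case (elim x)
      then show ?case
        using LIMSEQ_le_const[OF elim(2), of "K1 x"] LIMSEQ_le_const2[OF elim(2), of "K2 x"] by auto
    qed
    have "AE x in \<mu>. \<bar>g x\<bar> \<le> C1 + C2" using gb C1 C2 by eventually_elim linarith
    then have g_Linf: "g \<in> Linf \<mu>" by (rule Linf_I[OF g])
    have [measurable]: "K2 \<in> borel_measurable \<mu>" "\<And>n. f n \<in> borel_measurable \<mu>"
      using K(2) D(1) f Linf_measurable by blast+
    have "(\<lambda>n. \<integral>x. K2 x - f n x \<partial>Q) \<longlonglongrightarrow> (\<integral>x. K2 x - g x \<partial>Q)"
    proof (rule integral_dominated_convergence[where w = "\<lambda>_. C1 + C2"])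
      have "AE x in \<mu>. (\<lambda>n. K2 x - f n x) \<longlonglongrightarrow> K2 x - g x"
        using lim by eventually_elim (intro tendsto_intros)
      then show "AE x in Q. (\<lambda>n. K2 x - f n x) \<longlonglongrightarrow> K2 x - g x" by (rule AE_Q)
      have "AE x in \<mu>. norm (K2 x - f n x) \<le> C1 + C2" for n
        using fb C1 C2
      proof eventually_elim
        case (elim x)
        have "K1 x \<le> f n x" "f n x \<le> K2 x" using elim(1) by auto
        then show ?case using elim(2,3) unfolding real_norm_def abs_le_iff by linarith
      qed
      then show "AE x in Q. norm (K2 x - f n x) \<le> C1 + C2" for n by (rule AE_Q)
    qed auto
    then have "(\<integral>x. K2 x - g x \<partial>Q) \<le> \<gamma>" by (rule LIMSEQ_le_const2) (use D(3) f in auto)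
    then have "g \<in> ?D" using g_Linf gb unfolding dual_tests_def tests_between_def by simp
    then show "\<exists>h\<in>?D. AE x in \<mu>. h x = g x" by auto
  qed
  ultimately show ?thesis unfolding AE_compact_convex_def using bnd D(1) by blast
qed

lemma ess_upper_bound_AE:
  assumes "prob_space \<mu>" and K: "K1 \<in> Linf \<mu>" "K2 \<in> Linf \<mu>"
  shows "AE x in \<mu>. K2 x \<le> ess_upper_bound \<mu> K1 K2"
proof -
  interpret prob_space \<mu> by fact
  let ?E = "esssup \<mu> (\<lambda>x. ereal (max (K1 x) (K2 x)))"
  obtain C1 where C1: "AE x in \<mu>. \<bar>K1 x\<bar> \<le> C1" using Linf_bounded[OF K(1)] .
  obtain C2 where C2: "AE x in \<mu>. \<bar>K2 x\<bar> \<le> C2" using Linf_bounded[OF K(2)] .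
  have [measurable]: "K1 \<in> borel_measurable \<mu>" "K2 \<in> borel_measurable \<mu>"
    using K Linf_measurable by blast+
  have le: "AE x in \<mu>. ereal (max (K1 x) (K2 x)) \<le> ?E" by (rule esssup_AE)
  define C where "C = max C1 C2"
  have "AE x in \<mu>. max (K1 x) (K2 x) \<le> C" unfolding C_def using C1 C2 by eventually_elim linarith
  then have "AE x in \<mu>. ereal (max (K1 x) (K2 x)) \<le> ereal C" by (simp only: ereal_less_eq)
  then have "?E \<le> ereal C" by (intro esssup_I) auto
  moreover have "?E \<noteq> - \<infinity>"
  proof
    assume "?E = - \<infinity>"
    from le have "AE x in \<mu>. False"
      unfolding \<open>?E = - \<infinity>\<close> by eventually_elim (auto simp: max_def split: if_splits)
    then show False by simp
  qed
  ultimately have "ereal (ess_upper_bound \<mu> K1 K2) = ?E"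
    unfolding ess_upper_bound_def by (cases ?E) auto
  then have "AE x in \<mu>. max (K1 x) (K2 x) \<le> ess_upper_bound \<mu> K1 K2"
    using le by (simp only: flip: ereal_less_eq(3))
  then show ?thesis by eventually_elim linarith
qed

text \<open>
  A test in the dual set with expectation below the level could be moved a little towards \<open>K2\<close>
  while staying admissible. As \<open>\<gamma>\<close> is positive this strictly lowers \<open>E\<^sub>Q[K2 - X]\<close> below \<open>\<gamma>\<close>,
  which is impossible.
\<close>

lemma convex_expectation_ge_on_dual_tests:
  assumes "prob_space \<mu>" and Q: "Q \<in> ac_prob_measures \<mu>"
    and K2: "K2 \<in> Linf \<mu>"
    and \<rho>: "convex_expectation \<mu> \<rho>" and \<alpha>: "\<alpha> \<le> \<rho> K2"
    and \<gamma>: "\<gamma> = (INF X\<in>level_tests \<mu> \<rho> K1 K2 \<alpha>. integral\<^sup>L Q (\<lambda>x. K2 x - X x))"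
    and \<gamma>0: "0 < \<gamma>" and X: "X \<in> dual_tests \<mu> Q K1 K2 \<gamma>"
  shows "\<alpha> \<le> \<rho> X"
proof (rule ccontr)
  have ac: "absolutely_continuous \<mu> Q" and setsQ: "sets Q = sets \<mu>"
    using Q unfolding ac_prob_measures_def by auto
  have XL: "X \<in> Linf \<mu>" and Xb: "AE x in \<mu>. K1 x \<le> X x \<and> X x \<le> K2 x"
    and X\<gamma>: "integral\<^sup>L Q (\<lambda>x. K2 x - X x) \<le> \<gamma>"
    using X unfolding dual_tests_def tests_between_def by auto
  assume "\<not> \<alpha> \<le> \<rho> X"
  then have lt: "\<rho> X < \<alpha>" by simp
  \<comment> \<open>On the segment from X to K2 the convex bound on the expectation reaches the level here.\<close>
  define t where "t = (\<alpha> - \<rho> X) / (\<rho> K2 - \<rho> X)"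
  have t: "0 < t" "t \<le> 1" using lt \<alpha> unfolding t_def by auto
  define Z where "Z x = t * K2 x + (1 - t) * X x" for x
  have ZL: "Z \<in> Linf \<mu>" unfolding Z_def by (intro Linf_add Linf_cmult K2 XL)
  have "\<rho> Z \<le> t * \<rho> K2 + (1 - t) * \<rho> X"
    unfolding Z_def using t by (intro convex_expectation_convex[OF \<rho> K2 XL]) auto
  also have "\<dots> = \<rho> X + t * (\<rho> K2 - \<rho> X)" by (simp add: algebra_simps)
  also have "\<dots> = \<alpha>" using lt \<alpha> unfolding t_def by simp
  finally have "\<rho> Z \<le> \<alpha>" .
  moreover have "AE x in \<mu>. K1 x \<le> Z x \<and> Z x \<le> K2 x"
    using Xb
  proof eventually_elim
    case (elim x)
    have "Z x = X x + t * (K2 x - X x)" "Z x = K2 x - (1 - t) * (K2 x - X x)"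
      unfolding Z_def by (simp_all add: algebra_simps)
    moreover have "0 \<le> t * (K2 x - X x)" "0 \<le> (1 - t) * (K2 x - X x)" using elim t by auto
    ultimately show ?case using elim by linarith
  qed
  ultimately have Z: "Z \<in> level_tests \<mu> \<rho> K1 K2 \<alpha>"
    using ZL unfolding level_tests_def tests_between_def by simp
  have "bdd_below ((\<lambda>X. integral\<^sup>L Q (\<lambda>x. K2 x - X x)) ` level_tests \<mu> \<rho> K1 K2 \<alpha>)"
  proof (rule bdd_belowI2)
    fix X assume "X \<in> level_tests \<mu> \<rho> K1 K2 \<alpha>"
    then have "AE x in \<mu>. 0 \<le> K2 x - X x"
      unfolding level_tests_def tests_between_def by (auto elim: eventually_mono)
    then show "0 \<le> integral\<^sup>L Q (\<lambda>x. K2 x - X x)"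
      by (intro integral_nonneg_AE absolutely_continuous_AE[OF setsQ ac])
  qed
  then have "\<gamma> \<le> integral\<^sup>L Q (\<lambda>x. K2 x - Z x)" unfolding \<gamma> using Z by (rule cINF_lower)
  also have "\<dots> = integral\<^sup>L Q (\<lambda>x. (1 - t) * (K2 x - X x))"
    unfolding Z_def by (simp add: algebra_simps)
  also have "\<dots> = (1 - t) * integral\<^sup>L Q (\<lambda>x. K2 x - X x)" by simp
  also have "\<dots> \<le> (1 - t) * \<gamma>" using t X\<gamma> by (intro mult_left_mono) auto
  also have "\<dots> < \<gamma>" using t \<gamma>0 by (simp add: algebra_simps)
  finally show False by simp
qed

theorem theorem4p11:
  fixes \<mu> :: "'a measure"
    and \<rho>1 \<rho>2 :: "('a \<Rightarrow> real) \<Rightarrow> real"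
    and K1 K2 :: "'a \<Rightarrow> real"
    and \<alpha> \<gamma> :: real
    and Qs :: "'a measure"
  assumes "prob_space \<mu>"
    and "K1 \<in> Linf \<mu>" and "K2 \<in> Linf \<mu>"
    and "AE x in \<mu>. 0 \<le> K1 x" and "AE x in \<mu>. K1 x < K2 x"
    and "convex_expectation \<mu> \<rho>1" and "continuous_from_below \<mu> \<rho>1"
    and "convex_expectation \<mu> \<rho>2" and "continuous_from_below \<mu> \<rho>2"
    and "\<rho>1 K1 \<le> \<alpha>" and "\<alpha> \<le> \<rho>1 K2"
    and "\<exists>u v. u > max 0 (ess_upper_bound \<mu> K1 K2 - \<rho>1 (\<lambda>_. 0) + 1) \<and>
               v > max 0 (ess_upper_bound \<mu> K1 K2 - \<rho>2 (\<lambda>_. 0) + 1) \<and>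
               closed_under_AE_convergence \<mu> (density_level_set \<mu> \<rho>1 u) \<and>
               closed_under_AE_convergence \<mu> (density_level_set \<mu> \<rho>2 v)"
    and "Qs \<in> finite_penalty_measures \<mu> \<rho>2"
    and "\<And>X'. optimal_test \<mu> \<rho>1 \<rho>2 K1 K2 \<alpha> X' \<Longrightarrow>
           integral\<^sup>L Qs (\<lambda>x. K2 x - X' x) =
             (INF X\<in>level_tests \<mu> \<rho>1 K1 K2 \<alpha>. integral\<^sup>L Qs (\<lambda>x. K2 x - X x))"
    and "\<gamma> = (INF X\<in>level_tests \<mu> \<rho>1 K1 K2 \<alpha>. integral\<^sup>L Qs (\<lambda>x. K2 x - X x))"
    and "\<gamma> > 0"
  shows "\<exists>Ps\<in>finite_penalty_measures \<mu> \<rho>1.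
           \<forall>X'. optimal_test \<mu> \<rho>1 \<rho>2 K1 K2 \<alpha> X' \<longrightarrow>
             integral\<^sup>L Ps X' = (INF X\<in>dual_tests \<mu> Qs K1 K2 \<gamma>. integral\<^sup>L Ps X)"
proof -
  note \<mu> = assms(1) and K1 = assms(2) and K2 = assms(3) and \<rho>1 = assms(6)
  let ?D = "dual_tests \<mu> Qs K1 K2 \<gamma>"
  obtain u where u: "ess_upper_bound \<mu> K1 K2 - \<rho>1 (\<lambda>_. 0) + 1 < u"
    and cl: "closed_under_AE_convergence \<mu> (density_level_set \<mu> \<rho>1 u)"
    using assms(12) by auto
  have Q: "Qs \<in> ac_prob_measures \<mu>" using assms(13) unfolding finite_penalty_measures_def by blast
  have "\<rho>1 (\<lambda>_. 0) \<le> \<rho>1 K1"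
    by (rule convex_expectation_mono[OF \<rho>1 Linf_const K1]) (use assms(4) in simp)
  then have u': "ess_upper_bound \<mu> K1 K2 - \<alpha> + 1 \<le> u" using u assms(10) by linarith
  have K2_D: "K2 \<in> ?D"
    using K2 assms(5,16) unfolding dual_tests_def tests_between_def by (auto elim: eventually_mono)
  have ge: "\<alpha> \<le> \<rho>1 X" if "X \<in> ?D" for X
    by (rule convex_expectation_ge_on_dual_tests[OF \<mu> Q K2 \<rho>1 assms(11,15,16) that])
  obtain P where P: "P \<in> finite_penalty_measures \<mu> \<rho>1"
    and saddle: "\<And>X Y. X \<in> ?D \<Longrightarrow> Y \<in> Linf \<mu> \<Longrightarrow>
      integral\<^sup>L P Y - \<rho>1 Y \<le> integral\<^sup>L P X - \<alpha>"
    using saddle_measure_exists[OF \<mu> \<rho>1 assms(7) dual_tests_compact[OF \<mu> Q K1 K2] ge K2_D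
        ess_upper_bound_AE[OF \<mu> K1 K2] u' cl] by blast
  show ?thesis
  proof (intro bexI[OF _ P] allI impI)
    fix X' assume opt: "optimal_test \<mu> \<rho>1 \<rho>2 K1 K2 \<alpha> X'"
    then have X': "X' \<in> tests_between \<mu> K1 K2" "\<rho>1 X' \<le> \<alpha>"
      unfolding optimal_test_def level_tests_def by auto
    have X'_D: "X' \<in> ?D" using X'(1) assms(14)[OF opt] assms(15) unfolding dual_tests_def by simp
    have X'_Linf: "X' \<in> Linf \<mu>" using X'(1) unfolding tests_between_def by blast
    have min: "integral\<^sup>L P X' \<le> integral\<^sup>L P X" if "X \<in> ?D" for X
      using saddle[OF that X'_Linf] X'(2) by linarith
    show "integral\<^sup>L P X' = (INF X\<in>?D. integral\<^sup>L P X)"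
      by (rule cInf_eq_minimum[symmetric]) (use X'_D min in auto)
  qed
qed

end
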